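(* The algebras $A_\infty$ and $A_\infty^\circ$ are naturally isomorphic: the linear map $A_\infty^\circ\to A_\infty$ sending each Young diagram $\Delta$ to $G_\infty(\Delta)$ is an isomorphism of algebras.
   Context: Vector spaces are over $\mathbb{C}$; algebras are not required to have a unit; Young diagrams have degree $\ge 1$. The algebra $A_\infty$. A finite permutation of $\mathbb{N}=\{1,2,\dots\}$ is a pair $(d,w)$, where $d\subset\mathbb{N}$ is a finite nonempty set and $w$ is a permutation of $d$ (extended by the identity outside $d$). The product is $(d_1,w_1)(d_2,w_2)=(d_1\cup d_2,\,w_1w_2)$. The cyclic type of $(d,w)$ is the Young diagram of degree $|d|$ whose row lengths are the lengths of all cycles of $w$ on $d$ (fixed points in $d$ included). For a Young diagram $\Delta$, $G_\infty(\Delta)$ is the formal (infinite) sum of all finite permutations $(d,w)$ of cyclic type $\Delta$. $A_\infty$ is the vector space spanned by all the $G_\infty(\Delta)$, with multiplication induced by the multiplication of finite permutations (each product $G_\infty(\Delta_1)G_\infty(\Delta_2)$ is a finite linear combination of $G_\infty(\Delta)$'s). The algebra $A_\infty^\circ$. For $n\ge 1$, $\mathcal{A}_n$ is the set of Young diagrams of degree $|\Delta|=n$, $G_n(\Delta)\in\mathbb{C}[S_n]$ is the sum of all permutations in $S_n$ of cyclic type $\Delta$, and $C_{\Delta_1,\Delta_2}^{\Delta}$ is defined by $G_n(\Delta_1)G_n(\Delta_2)=\sum_{\Delta\in\mathcal{A}_n}C_{\Delta_1,\Delta_2}^{\Delta}G_n(\Delta)$. $A_n^\circ$ is the vector space with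 basis $\mathcal{A}_n$ and multiplication $\Delta_1\circ\Delta_2=\sum_{\Delta\in\mathcal{A}_n}C_{\Delta_1,\Delta_2}^{\Delta}\Delta$. For $k\ge 0$, the linear map $\rho_k:A_n^\circ\to A_{n+k}^\circ$ is given by $\rho_k(\Delta)=\frac{(r+k)!}{r!\,k!}\Delta^k$, where $\Delta^k$ is obtained from $\Delta$ by adding $k$ rows of length $1$, and $r$ is the number of rows of length $1$ in $\Delta$. For Young diagrams $\Delta_1,\Delta_2$, set $M=\max\{|\Delta_1|,|\Delta_2|\}$ and define recursively $$\{\Delta_1\Delta_2\}_M=\rho_{M-|\Delta_1|}(\Delta_1)\circ\rho_{M-|\Delta_2|}(\Delta_2),$$ $$\{\Delta_1\Delta_2\}_n=\rho_{n-|\Delta_1|}(\Delta_1)\circ\rho_{n-|\Delta_2|}(\Delta_2)-\sum_{k=M}^{n-1}\rho_{n-k}(\{\Delta_1\Delta_2\}_k)\quad (n>M).$$ $A_\infty^\circ=\bigoplus_{n}A_n^\circ$ with the bilinear multiplication $\Delta_1\Delta_2:=\sum_{n=M}^{|\Delta_1|+|\Delta_2|}\{\Delta_1\Delta_2\}_n$. *)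

theory Defs
  imports
    Complex_Main
    "HOL-Library.Multiset"
    "HOL-Library.Function_Algebras"
    "HOL-Library.Indicator_Function"
    "HOL-Combinatorics.Permutations"
    "HOL-Combinatorics.Orbits"
begin

section \<open>Complex vector spaces of formal sums\<close>

text \<open>
  A formal sum of elements of \<open>'a\<close>, finite or infinite, is its coefficient function
  \<open>'a \<Rightarrow> complex\<close>; the basis element \<open>a\<close> is \<open>indicator {a}\<close>. Addition is the pointwise
  addition of \<^theory>\<open>HOL-Library.Function_Algebras\<close>; the pointwise product of functions
  provided there is never used.
\<close>

definition fscale :: "complex \<Rightarrow> ('a \<Rightarrow> complex) \<Rightarrow> 'a \<Rightarrow> complex" where
  "fscale c x = (\<lambda>a. c * x a)"

interpretation fun_space: vector_space "fscale :: complex \<Rightarrow> ('a \<Rightarrow> complex) \<Rightarrow> 'a \<Rightarrow> complex"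
  by unfold_locales (auto simp: fscale_def algebra_simps fun_eq_iff)

text \<open>
  The linear, respectively bilinear, extension of a map given on basis elements. It is meant for
  arguments of finite support only.
\<close>

definition lin_ext :: "('a \<Rightarrow> 'b \<Rightarrow> complex) \<Rightarrow> ('a \<Rightarrow> complex) \<Rightarrow> 'b \<Rightarrow> complex" where
  "lin_ext f x = (\<Sum>a\<in>{a. x a \<noteq> 0}. fscale (x a) (f a))"

definition bilin_ext ::
    "('a \<Rightarrow> 'a \<Rightarrow> 'b \<Rightarrow> complex) \<Rightarrow> ('a \<Rightarrow> complex) \<Rightarrow> ('a \<Rightarrow> complex) \<Rightarrow> 'b \<Rightarrow> complex" where
  "bilin_ext f x y = lin_ext (\<lambda>a. lin_ext (f a) y) x"

text \<open>Algebras are associative, but not required to have a unit.\<close>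

definition is_algebra ::
    "('a \<Rightarrow> complex) set \<Rightarrow> (('a \<Rightarrow> complex) \<Rightarrow> ('a \<Rightarrow> complex) \<Rightarrow> 'a \<Rightarrow> complex) \<Rightarrow> bool" where
  "is_algebra A m \<longleftrightarrow>
     fun_space.subspace A \<and>
     (\<forall>x\<in>A. \<forall>y\<in>A. m x y \<in> A) \<and>
     (\<forall>x\<in>A. \<forall>y\<in>A. \<forall>z\<in>A. m (x + y) z = m x z + m y z \<and> m z (x + y) = m z x + m z y) \<and>
     (\<forall>c. \<forall>x\<in>A. \<forall>y\<in>A. m (fscale c x) y = fscale c (m x y) \<and> m x (fscale c y) = fscale c (m x y)) \<and>
     (\<forall>x\<in>A. \<forall>y\<in>A. \<forall>z\<in>A. m (m x y) z = m x (m y z))"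

definition is_algebra_iso ::
    "('a \<Rightarrow> complex) set \<Rightarrow> (('a \<Rightarrow> complex) \<Rightarrow> ('a \<Rightarrow> complex) \<Rightarrow> 'a \<Rightarrow> complex) \<Rightarrow>
     ('b \<Rightarrow> complex) set \<Rightarrow> (('b \<Rightarrow> complex) \<Rightarrow> ('b \<Rightarrow> complex) \<Rightarrow> 'b \<Rightarrow> complex) \<Rightarrow>
     (('a \<Rightarrow> complex) \<Rightarrow> 'b \<Rightarrow> complex) \<Rightarrow> bool" where
  "is_algebra_iso A m B m' \<phi> \<longleftrightarrow>
     is_algebra A m \<and> is_algebra B m' \<and>
     bij_betw \<phi> A B \<and>
     (\<forall>x\<in>A. \<forall>y\<in>A. \<phi> (x + y) = \<phi> x + \<phi> y) \<and>
     (\<forall>c. \<forall>x\<in>A. \<phi> (fscale c x) = fscale c (\<phi> x)) \<and>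
     (\<forall>x\<in>A. \<forall>y\<in>A. \<phi> (m x y) = m' (\<phi> x) (\<phi> y))"


section \<open>Young diagrams and cyclic types\<close>

text \<open>A Young diagram is the multiset of its row lengths; its degree is \<^const>\<open>sum_mset\<close>.\<close>

definition young_diagrams :: "nat multiset set" where
  "young_diagrams = {\<Delta>. \<Delta> \<noteq> {#} \<and> 0 \<notin># \<Delta>}"

definition young_of_degree :: "nat \<Rightarrow> nat multiset set" where
  "young_of_degree n = {\<Delta> \<in> young_diagrams. sum_mset \<Delta> = n}"

lemma finite_young_of_degree: "finite (young_of_degree n)"
proof -
  have "young_of_degree n \<subseteq> mset ` {xs. set xs \<subseteq> {0..n} \<and> length xs \<le> n}"
  proof
    fix \<Delta> assume D: "\<Delta> \<in> young_of_degree n"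
    obtain xs where xs: "mset xs = \<Delta>" using ex_mset by blast
    have s: "sum_list xs = n"
      using D by (simp add: young_of_degree_def sum_mset_sum_list flip: xs)
    have "0 \<notin> set xs"
      using D by (simp add: young_of_degree_def young_diagrams_def flip: xs)
    then have pos: "\<forall>x\<in>set xs. 1 \<le> x"
      by (metis less_one not_le)
    have "length xs \<le> sum_list xs" using pos by (induction xs) force+
    moreover have "set xs \<subseteq> {0..n}" using s member_le_sum_list[of _ xs] by auto
    ultimately have "xs \<in> {xs. set xs \<subseteq> {0..n} \<and> length xs \<le> n}" using s by simp
    then show "\<Delta> \<in> mset ` {xs. set xs \<subseteq> {0..n} \<and> length xs \<le> n}" using xs by blast
  qed
  moreover have "finite {xs. set xs \<subseteq> {0..n} \<and> length xs \<le> n}"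
    by (rule finite_lists_length_le) simp
  ultimately show ?thesis by (meson finite_imageI finite_subset)
qed

text \<open>
  For a permutation \<open>w\<close> of a finite set \<open>d\<close>, the sets \<open>orbit w x\<close> with \<open>x \<in> d\<close> are the supports of
  the cycles of \<open>w\<close> on \<open>d\<close>, a fixed point \<open>x\<close> giving the cycle \<open>{x}\<close>.
\<close>

definition cyclic_type :: "nat set \<Rightarrow> (nat \<Rightarrow> nat) \<Rightarrow> nat multiset" where
  "cyclic_type d w = image_mset card (mset_set (orbit w ` d))"


section \<open>The algebra of formal sums of finite permutations\<close>

definition finite_perms :: "(nat set \<times> (nat \<Rightarrow> nat)) set" where
  "finite_perms = {(d, w). finite d \<and> d \<noteq> {} \<and> 0 \<notin> d \<and> w permutes d}"

definition finite_perm_mult ::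
    "nat set \<times> (nat \<Rightarrow> nat) \<Rightarrow> nat set \<times> (nat \<Rightarrow> nat) \<Rightarrow> nat set \<times> (nat \<Rightarrow> nat)" where
  "finite_perm_mult p q = (fst p \<union> fst q, snd p \<circ> snd q)"

definition finite_perm_factors ::
    "nat set \<times> (nat \<Rightarrow> nat) \<Rightarrow>
     ((nat set \<times> (nat \<Rightarrow> nat)) \<times> nat set \<times> (nat \<Rightarrow> nat)) set" where
  "finite_perm_factors p =
     {(p1, p2). p1 \<in> finite_perms \<and> p2 \<in> finite_perms \<and> finite_perm_mult p1 p2 = p}"

text \<open>
  A finite permutation has finitely many factorizations, so infinite formal sums can be multiplied.
\<close>

lemma finite_finite_perm_factors: "finite (finite_perm_factors p)"
proof (cases "finite (fst p)")
  case True
  let ?P = "Pow (fst p) \<times> (\<Union>d\<in>Pow (fst p). {w. w permutes d})"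
  have "finite {w. w permutes d}" if "d \<in> Pow (fst p)" for d
    using that True by (intro finite_permutations) (auto intro: finite_subset)
  then have "finite ?P" using True by simp
  moreover have "finite_perm_factors p \<subseteq> ?P \<times> ?P"
    by (auto simp: finite_perm_factors_def finite_perms_def finite_perm_mult_def)
  ultimately show ?thesis by (meson finite_SigmaI finite_subset)
next
  case False
  then have "finite_perm_factors p = {}"
    by (auto simp: finite_perm_factors_def finite_perms_def finite_perm_mult_def)
  then show ?thesis by simp
qed

definition A_inf_mult ::
    "(nat set \<times> (nat \<Rightarrow> nat) \<Rightarrow> complex) \<Rightarrow> (nat set \<times> (nat \<Rightarrow> nat) \<Rightarrow> complex) \<Rightarrow>
     nat set \<times> (nat \<Rightarrow> nat) \<Rightarrow> complex" where
  "A_inf_mult x y = (\<lambda>p. \<Sum>(p1, p2)\<in>finite_perm_factors p. x p1 * y p2)"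

definition G_inf :: "nat multiset \<Rightarrow> nat set \<times> (nat \<Rightarrow> nat) \<Rightarrow> complex" where
  "G_inf \<Delta> = indicator {(d, w) \<in> finite_perms. cyclic_type d w = \<Delta>}"

definition A_inf :: "(nat set \<times> (nat \<Rightarrow> nat) \<Rightarrow> complex) set" where
  "A_inf = fun_space.span (G_inf ` young_diagrams)"


section \<open>The algebra spanned by Young diagrams\<close>

subsection \<open>Conjugacy classes in the group algebra of the symmetric group\<close>

definition group_algebra_mult ::
    "nat \<Rightarrow> ((nat \<Rightarrow> nat) \<Rightarrow> complex) \<Rightarrow> ((nat \<Rightarrow> nat) \<Rightarrow> complex) \<Rightarrow> (nat \<Rightarrow> nat) \<Rightarrow> complex" where
  "group_algebra_mult n x y =
     (\<lambda>w. \<Sum>(u, v)\<in>{(u, v). u permutes {1..n} \<and> v permutes {1..n} \<and> u \<circ> v = w}. x u * y v)"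

definition G_fin :: "nat \<Rightarrow> nat multiset \<Rightarrow> (nat \<Rightarrow> nat) \<Rightarrow> complex" where
  "G_fin n \<Delta> = indicator {w. w permutes {1..n} \<and> cyclic_type {1..n} w = \<Delta>}"

text \<open>
  For \<open>\<Delta>1\<close>, \<open>\<Delta>2\<close> of degree \<open>n\<close> the coefficients exist because products of class sums are class
  functions, and are unique because the class sums are linearly independent.
\<close>

definition class_coeff :: "nat \<Rightarrow> nat multiset \<Rightarrow> nat multiset \<Rightarrow> nat multiset \<Rightarrow> complex" where
  "class_coeff n \<Delta>1 \<Delta>2 =
     (THE C. (\<forall>\<Delta>. \<Delta> \<notin> young_of_degree n \<longrightarrow> C \<Delta> = 0) \<and>
        group_algebra_mult n (G_fin n \<Delta>1) (G_fin n \<Delta>2) =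
          (\<Sum>\<Delta>\<in>young_of_degree n. fscale (C \<Delta>) (G_fin n \<Delta>)))"

definition A_circ_mult ::
    "nat \<Rightarrow> (nat multiset \<Rightarrow> complex) \<Rightarrow> (nat multiset \<Rightarrow> complex) \<Rightarrow> nat multiset \<Rightarrow> complex" where
  "A_circ_mult n =
     bilin_ext (\<lambda>\<Delta>1 \<Delta>2. \<Sum>\<Delta>\<in>young_of_degree n. fscale (class_coeff n \<Delta>1 \<Delta>2 \<Delta>) (indicator {\<Delta>}))"

subsection \<open>The stable product\<close>

definition add_unit_rows :: "nat \<Rightarrow> nat multiset \<Rightarrow> nat multiset" where
  "add_unit_rows k \<Delta> = \<Delta> + replicate_mset k 1"

definition rho :: "nat \<Rightarrow> (nat multiset \<Rightarrow> complex) \<Rightarrow> nat multiset \<Rightarrow> complex" where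
  "rho k =
     lin_ext (\<lambda>\<Delta>. fscale (fact (count \<Delta> 1 + k) / (fact (count \<Delta> 1) * fact k))
                    (indicator {add_unit_rows k \<Delta>}))"

abbreviation max_degree :: "nat multiset \<Rightarrow> nat multiset \<Rightarrow> nat" where
  "max_degree \<Delta>1 \<Delta>2 \<equiv> max (sum_mset \<Delta>1) (sum_mset \<Delta>2)"

text \<open>
  The component of degree \<open>n\<close> of the product; only \<open>n \<ge> max_degree \<Delta>1 \<Delta>2\<close> matters. For
  \<open>n = max_degree \<Delta>1 \<Delta>2\<close> the subtracted sum is empty.
\<close>

function bracket :: "nat multiset \<Rightarrow> nat multiset \<Rightarrow> nat \<Rightarrow> nat multiset \<Rightarrow> complex" where
  "bracket \<Delta>1 \<Delta>2 n =
     A_circ_mult n (rho (n - sum_mset \<Delta>1) (indicator {\<Delta>1})) (rho (n - sum_mset \<Delta>2) (indicator {\<Delta>2}))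
     - (\<Sum>k\<in>{max_degree \<Delta>1 \<Delta>2..<n}. rho (n - k) (bracket \<Delta>1 \<Delta>2 k))"
  by pat_completeness auto
termination by (relation "measure (\<lambda>(\<Delta>1, \<Delta>2, n). n)") auto

declare bracket.simps [simp del]

text \<open>The direct sum of the spaces with basis \<^const>\<open>young_of_degree\<close> \<open>n\<close>, \<open>n \<ge> 1\<close>.\<close>

definition A_circ_inf :: "(nat multiset \<Rightarrow> complex) set" where
  "A_circ_inf = {x. finite {\<Delta>. x \<Delta> \<noteq> 0} \<and> {\<Delta>. x \<Delta> \<noteq> 0} \<subseteq> young_diagrams}"

definition A_circ_inf_mult ::
    "(nat multiset \<Rightarrow> complex) \<Rightarrow> (nat multiset \<Rightarrow> complex) \<Rightarrow> nat multiset \<Rightarrow> complex" where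
  "A_circ_inf_mult =
     bilin_ext (\<lambda>\<Delta>1 \<Delta>2. \<Sum>n = max_degree \<Delta>1 \<Delta>2..sum_mset \<Delta>1 + sum_mset \<Delta>2. bracket \<Delta>1 \<Delta>2 n)"

text \<open>The linear map with \<open>\<Delta> \<mapsto> G_inf \<Delta>\<close>.\<close>

definition G_inf_map :: "(nat multiset \<Rightarrow> complex) \<Rightarrow> nat set \<times> (nat \<Rightarrow> nat) \<Rightarrow> complex" where
  "G_inf_map = lin_ext G_inf"

end

theory Submission
  imports Defs
begin

text \<open>
  The isomorphism is proved by evaluating formal sums in the symmetric groups.
  
  A formal sum in \<^const>\<open>A_inf\<close> is a function on finite permutations that depends only on the cyclic
  type, so \<^const>\<open>G_inf_map\<close> turns a function on Young diagrams into the corresponding class function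
  (\<open>G_inf_map_eq_class_fun\<close>). As every Young diagram is the type of some finite permutation, this is a
  linear bijection. Finite permutations of equal type are conjugate, so the product of two class sums
  is a class function \<open>c\<close> on diagrams, supported in the degrees between the maximum and the sum of the
  degrees of the factors (\<open>G_inf_mult_eq_class_fun\<close>). It remains to recognise \<open>c\<close> as the sum of the
  brackets.
  
  For this, let a formal sum act in the group algebra of the symmetric group on \<open>{1..n}\<close> by \<open>(d, w) \<mapsto> w\<close>
  if \<open>d \<subseteq> {1..n}\<close>, and \<open>0\<close> otherwise. This evaluation is multiplicative (\<open>perm_eval_mult\<close>). A permutation
  \<open>w\<close> of \<open>{1..n}\<close> arises from each \<open>(d, w)\<close> with \<open>d\<close> nonempty and \<open>{1..n} - d\<close> a set of fixed points of \<open>w\<close>, so the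
  coefficient of \<open>w\<close> in the evaluation of \<open>c\<close> is a sum over \<open>k\<close> of the number of ways to choose \<open>k\<close> fixed
  points, times the value of \<open>c\<close> on the type of \<open>w\<close> without \<open>k\<close> unit rows. That sum is \<open>\<Sum>k. rho k c\<close>: the
  maps \<^const>\<open>rho\<close> are exactly the evaluation in terms of diagrams (\<open>perm_eval_class_fun_rho\<close>). Evaluating
  \<open>G_inf \<Delta>1 * G_inf \<Delta>2\<close> in degree \<open>n\<close> in two ways gives
  \<open>rho (n - |\<Delta>1|) \<Delta>1 \<circ> rho (n - |\<Delta>2|) \<Delta>2 = (\<Sum>k\<le>n. rho (n - k) c\<^sub>k)\<close>, where \<open>c\<^sub>k\<close> is the component of \<open>c\<close> of
  degree \<open>k\<close>. Solved for \<open>c\<^sub>n\<close>, this is the recursion for the brackets (\<open>bracket_eq\<close>).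
  
  The formal sums form an associative algebra because finite permutations form a semigroup, and
  associativity of the stable product of diagrams follows through the bijection.
\<close>

section \<open>The cyclic type of a permutation\<close>

lemma cyclic_type_disjoint_comp:
  assumes "finite a" "finite b" "a \<inter> b = {}" and u: "u permutes a" and v: "v permutes b"
  shows "cyclic_type (a \<union> b) (u \<circ> v) = cyclic_type a u + cyclic_type b v"
proof -
  have ua: "u x = x" if "x \<notin> a" for x using u that by (simp add: permutes_not_in)
  have vb: "v x = x" if "x \<notin> b" for x using v that by (simp add: permutes_not_in)
  have "orbit u x = orbit (u \<circ> v) x" if "x \<in> a" for x
  proof (rule orbit_cong0[of _ a])
    show "u \<in> a \<rightarrow> a" using u by (auto simp: permutes_in_image)
    show "u y = (u \<circ> v) y" if "y \<in> a" for y using that assms(3) vb[of y] by (simp add: disjoint_iff)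
  qed (use that in auto)
  moreover have "orbit v x = orbit (u \<circ> v) x" if "x \<in> b" for x
  proof (rule orbit_cong0[of _ b])
    show vv: "v \<in> b \<rightarrow> b" using v by (auto simp: permutes_in_image)
    show "v y = (u \<circ> v) y" if "y \<in> b" for y
      using assms(3) ua[of "v y"] funcset_mem[OF vv that] by (metis disjoint_iff comp_apply)
  qed (use that in auto)
  ultimately have eq: "orbit (u \<circ> v) ` (a \<union> b) = orbit u ` a \<union> orbit v ` b"
    by (simp add: image_Un)
  have "orbit u ` a \<inter> orbit v ` b = {}"
  proof -
    have "orbit u x \<noteq> orbit v y" if "x \<in> a" "y \<in> b" for x y
      using permutes_orbit_subset[OF u that(1)] permutes_orbit_subset[OF v that(2)]
        orbit_nonempty[of u x] assms(3) by blast
    then show ?thesis by blast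
  qed
  then show ?thesis
    using assms(1,2) by (simp add: cyclic_type_def eq mset_set_Union)
qed

lemma cyclic_type_cycle:
  assumes "cyclic_on v b"
  shows "cyclic_type b v = {#card b#}"
proof -
  have "orbit v ` b = {b}" using assms unfolding cyclic_on_alldef by blast
  then show ?thesis by (simp add: cyclic_type_def)
qed

lemma cyclic_type_id:
  assumes "finite b"
  shows "cyclic_type b id = replicate_mset (card b) 1"
proof -
  have "orbit id x = {x}" for x :: nat by (simp add: orbit_eq_singleton_iff)
  then have "orbit id ` b = (\<lambda>x. {x}) ` b" by (auto simp: image_def)
  then show ?thesis
    by (simp add: cyclic_type_def image_mset_mset_set[symmetric] image_mset.compositionality
        comp_def image_mset_const_eq)
qed

text \<open>
  The inductive step for permutations of finite sets: the orbit of a point carries a cycle, and what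
  is left of the permutation lives on the complement of that orbit.
\<close>

lemma split_off_orbit:
  assumes "w permutes d" "finite d" "x \<in> d"
  obtains a u v where "a \<inter> orbit w x = {}" "d = a \<union> orbit w x" "w = u \<circ> v" "u permutes a"
    "v permutes orbit w x" "cyclic_on v (orbit w x)" "finite a" "finite (orbit w x)"
proof -
  define b where "b = orbit w x"
  have cyc: "cyclic_on w b" unfolding b_def by (rule cyclic_on_orbit) fact+
  have bd: "b \<subseteq> d" unfolding b_def by (rule permutes_orbit_subset) fact+
  have fin: "finite b" using bd assms finite_subset by blast
  have u: "perm_restrict w (d - b) permutes (d - b)"
    by (rule perm_restrict_diff_cyclic) fact+
  have "w ` b = b"
  proof (rule endo_inj_surj[OF fin])
    show "w ` b \<subseteq> b" using cyc by (auto intro: cyclic_on_inI)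
    show "inj_on w b" using assms(1) by (meson inj_on_subset permutes_inj subset_UNIV)
  qed
  then have v: "perm_restrict w b permutes b"
    by (intro bij_imp_permutes)
      (auto simp: perm_restrict_def bij_betw_def inj_on_def dest: permutes_inj[OF assms(1), THEN injD])
  have "w = perm_restrict w (d - b) \<circ> perm_restrict w b"
    using perm_restrict_union[OF u v] bd perm_restrict_id[OF assms(1)] by (simp add: Un_absorb2 Int_commute)
  then show ?thesis
    using that[of "d - b" "perm_restrict w (d - b)" "perm_restrict w b"] bd u v fin assms(2) cyc
    by (simp add: b_def[symmetric] cyclic_on_perm_restrict Un_absorb2 Int_commute)
qed

text \<open>
  Permutations of finite sets are built from the empty one by adjoining disjoint cycles; together
  with \<open>cyclic_type_disjoint_comp\<close> and \<open>cyclic_type_cycle\<close> this computes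
  the invariants of the cyclic type and constructs conjugations.
\<close>

lemma permutes_cycle_induct [consumes 2, case_names empty cycle]:
  assumes "finite d" "w permutes d"
    and empty: "P {} id"
    and cycle: "\<And>a b u v. \<lbrakk>finite a; finite b; a \<inter> b = {}; u permutes a; v permutes b;
      cyclic_on v b; P a u\<rbrakk> \<Longrightarrow> P (a \<union> b) (u \<circ> v)"
  shows "P d w"
  using assms(1,2)
proof (induction d arbitrary: w rule: finite_psubset_induct)
  case (psubset d)
  show ?case
  proof (cases "d = {}")
    case True then show ?thesis using psubset.prems empty by (metis permutes_empty)
  next
    case False
    then obtain x where x: "x \<in> d" by blast
    obtain a u v where s: "a \<inter> orbit w x = {}" "d = a \<union> orbit w x" "w = u \<circ> v" "u permutes a"
      "v permutes orbit w x" "cyclic_on v (orbit w x)" "finite a" "finite (orbit w x)"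
      using split_off_orbit[OF psubset.prems psubset.hyps x] by metis
    have "a \<subset> d" using s(1,2) orbit_nonempty[of w x] by auto
    then have "P a u" using psubset.IH s(4) by blast
    then show ?thesis using cycle s by metis
  qed
qed

lemma sum_mset_cyclic_type:
  assumes "finite d" "w permutes d"
  shows "sum_mset (cyclic_type d w) = card d"
  using assms
proof (induction rule: permutes_cycle_induct)
  case empty then show ?case by (simp add: cyclic_type_def)
next
  case (cycle a b u v)
  then have "cyclic_type (a \<union> b) (u \<circ> v) = cyclic_type a u + {#card b#}"
    by (metis cyclic_type_disjoint_comp cyclic_type_cycle)
  then show ?case using cycle by (simp only: card_Un_disjoint) simp
qed

lemma zero_not_in_cyclic_type:
  assumes "finite d" "w permutes d"
  shows "0 \<notin># cyclic_type d w"
  using assms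
proof (induction rule: permutes_cycle_induct)
  case empty then show ?case by (simp add: cyclic_type_def)
next
  case (cycle a b u v)
  then have "cyclic_type (a \<union> b) (u \<circ> v) = cyclic_type a u + {#card b#}"
    by (metis cyclic_type_disjoint_comp cyclic_type_cycle)
  moreover have "b \<noteq> {}" using \<open>cyclic_on v b\<close> by (auto simp: cyclic_on_def)
  ultimately show ?case using cycle by (simp only:) simp
qed

lemma cyclic_type_in_young_of_degree:
  assumes "finite d" "w permutes d" "d \<noteq> {}"
  shows "cyclic_type d w \<in> young_of_degree (card d)"
proof -
  have "card d > 0" using assms by (simp add: card_gt_0_iff)
  then have "cyclic_type d w \<noteq> {#}" using sum_mset_cyclic_type[OF assms(1,2)] by auto
  then show ?thesis
    using sum_mset_cyclic_type[OF assms(1,2)] zero_not_in_cyclic_type[OF assms(1,2)]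
    by (simp add: young_of_degree_def young_diagrams_def)
qed

text \<open>
  Along an enumeration of \<open>b\<close> by residues modulo \<open>N = card b\<close>, the successor map modulo \<open>N\<close> is a
  cycle through all of \<open>b\<close>.
\<close>

lemma ex_cyclic_permutation:
  assumes "finite (b :: 'a set)" "b \<noteq> {}"
  shows "\<exists>v. v permutes b \<and> cyclic_on v b"
proof -
  define N where "N = card b"
  have N: "N > 0" using assms by (simp add: N_def card_gt_0_iff)
  obtain h where h: "bij_betw h {0..<N} b"
    using ex_bij_betw_nat_finite[OF assms(1)] N_def by blast
  define g where "g = inv_into {0..<N} h"
  have gh: "g (h n) = n" if "n < N" for n
    using h that unfolding g_def bij_betw_def by (metis atLeastLessThan_iff inv_into_f_f le0)
  define v where "v = (\<lambda>y. if y \<in> b then h (Suc (g y) mod N) else y)"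
  have hb: "h n \<in> b" if "n < N" for n using h that by (auto simp: bij_betw_def)
  have vh: "v (h n) = h (Suc n mod N)" if "n < N" for n
    using that by (simp add: v_def hb gh)
  have "b \<subseteq> v ` b"
  proof
    fix y assume "y \<in> b"
    then obtain n where n: "n < N" "y = h n" using h by (auto simp: bij_betw_def)
    \<comment> \<open>the predecessor of \<open>n\<close> modulo \<open>N\<close>\<close>
    define m where "m = (if n = 0 then N - 1 else n - 1)"
    have "m < N" "Suc m mod N = n" using n N by (auto simp: m_def)
    then have "v (h m) = y" using vh n by simp
    then show "y \<in> v ` b" using hb[OF \<open>m < N\<close>] by blast
  qed
  moreover have "v ` b \<subseteq> b" using N by (auto simp: v_def intro!: hb)
  ultimately have "v ` b = b" by blast
  then have "bij_betw v b b" using assms(1) by (simp add: bij_betw_def finite_surj_inj)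
  then have "v permutes b" by (rule bij_imp_permutes) (simp add: v_def)
  moreover have pow: "(v ^^ n) (h 0) = h (n mod N)" for n
    by (induction n) (use N in \<open>simp_all add: vh mod_Suc_eq\<close>)
  have "orbit v (h 0) = b"
  proof
    show "orbit v (h 0) \<subseteq> b" using pow N by (auto simp: orbit_altdef intro!: hb)
    show "b \<subseteq> orbit v (h 0)"
    proof
      fix y assume "y \<in> b"
      then obtain n where n: "n < N" "y = h n" using h by (auto simp: bij_betw_def)
      \<comment> \<open>the summand \<open>N\<close> makes the exponent positive, as \<open>orbit\<close> demands\<close>
      then have "(v ^^ (n + N)) (h 0) = y" by (simp add: pow)
      then show "y \<in> orbit v (h 0)" using N by (fastforce simp: orbit_altdef)
    qed
  qed
  then have "cyclic_on v b" using hb[OF N] by (auto simp: cyclic_on_def)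
  ultimately show ?thesis by blast
qed

text \<open>
  Cut \<open>d\<close> into blocks of the prescribed sizes and put a cycle on each. The existence of such \<open>w\<close>
  is what makes class functions determine their coefficients.
\<close>

lemma ex_permutation_of_cyclic_type:
  assumes "finite d" "sum_mset \<Delta> = card d" "0 \<notin># \<Delta>"
  shows "\<exists>w. w permutes d \<and> cyclic_type d w = \<Delta>"
  using assms
proof (induction \<Delta> arbitrary: d)
  case empty
  then show ?case by (auto simp: cyclic_type_def intro!: exI[of _ id])
next
  case (add m \<Delta>)
  have "m \<le> card d" using add.prems by simp
  then obtain b where b: "b \<subseteq> d" "card b = m"
    by (meson obtain_subset_with_card_n)
  have fb: "finite b" using b add.prems finite_subset by blast
  have "m > 0" using add.prems by auto
  then have "b \<noteq> {}" using b by auto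
  then obtain v where v: "v permutes b" "cyclic_on v b" using ex_cyclic_permutation fb by blast
  have "card (d - b) = sum_mset \<Delta>" using b fb add.prems by (simp add: card_Diff_subset)
  then obtain u where u: "u permutes (d - b)" "cyclic_type (d - b) u = \<Delta>"
    using add.IH[of "d - b"] add.prems by auto
  have "d - b \<union> b = d" using b by auto
  then have "cyclic_type d (u \<circ> v) = add_mset m \<Delta>"
    using cyclic_type_disjoint_comp[of "d - b" b u v] u v fb add.prems b
    by (simp add: cyclic_type_cycle Int_commute)
  moreover have "u \<circ> v permutes d"
    using u v b by (meson Diff_subset permutes_compose permutes_subset)
  ultimately show ?case by blast
qed

section \<open>Permutations with the same cyclic type are conjugate\<close>

lemma cyclic_on_enum:
  assumes "cyclic_on v b"
  obtains x where "x \<in> b" "bij_betw (\<lambda>n. (v ^^ n) x) {0..<card b} b" "(v ^^ card b) x = x"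
proof -
  obtain x where x: "x \<in> b" "orbit v x = b" using assms by (auto simp: cyclic_on_def)
  then have xo: "x \<in> orbit v x" by simp
  define N where "N = funpow_dist1 v x x"
  have inj: "inj_on (\<lambda>n. (v ^^ n) x) {0..<N}" unfolding N_def by (rule inj_on_funpow_dist1[OF xo])
  have im: "(\<lambda>n. (v ^^ n) x) ` {0..<N} = b"
    using orbit_conv_funpow_dist1[OF xo] x unfolding N_def by simp
  have "card b = N" using card_image[OF inj] im by simp
  moreover have "(v ^^ N) x = x" unfolding N_def by (rule funpow_dist1_prop[OF xo])
  ultimately show ?thesis using that[OF x(1)] inj im by (simp add: bij_betw_def)
qed

text \<open>
  Both cycles are the successor map on residues modulo their common length, so matching the two
  enumerations intertwines them.
\<close>

lemma cycles_conjugate: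
  assumes "cyclic_on v b" "cyclic_on v' b'" "card b = card b'"
  shows "\<exists>g. bij_betw g b b' \<and> (\<forall>x\<in>b. g (v x) = v' (g x))"
proof -
  define N where "N = card b"
  obtain x where x: "x \<in> b" "bij_betw (\<lambda>n. (v ^^ n) x) {0..<N} b" "(v ^^ N) x = x"
    using cyclic_on_enum[OF assms(1)] N_def by metis
  obtain x' where x': "bij_betw (\<lambda>n. (v' ^^ n) x') {0..<N} b'" "(v' ^^ N) x' = x'"
    using cyclic_on_enum[OF assms(2)] N_def assms(3) by metis
  let ?h = "\<lambda>n. (v ^^ n) x" and ?h' = "\<lambda>n. (v' ^^ n) x'"
  define g where "g = ?h' \<circ> inv_into {0..<N} ?h"
  have bij: "bij_betw g b b'" unfolding g_def
    by (rule bij_betw_trans[OF bij_betw_inv_into[OF x(2)] x'(1)])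
  have gh: "g (?h n) = ?h' n" if "n < N" for n
    using bij_betw_inv_into_left[OF x(2), of n] that by (simp add: g_def)
  have "g (v y) = v' (g y)" if "y \<in> b" for y
  proof -
    obtain n where n: "n < N" "y = ?h n" using x(2) \<open>y \<in> b\<close> by (auto simp: bij_betw_def)
    show ?thesis
    proof (cases "Suc n < N")
      case True
      then show ?thesis using gh[OF True] gh[OF n(1)] n by simp
    next
      case False
      then have "Suc n = N" using n by simp
      then have "v y = ?h 0" "v' (?h' n) = ?h' 0"
        using x(3) x'(2) n by (metis funpow.simps(1,2) comp_apply id_apply)+
      then show ?thesis using gh[of 0] gh[OF n(1)] n by simp
    qed
  qed
  then show ?thesis using bij by blast
qed

text \<open>
  When the last cycle adjoined to \<open>w\<close> has length \<open>card b\<close>, the equality of types provides a cycle of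
  the same length in \<open>w'\<close>; the two cycles are matched by \<open>cycles_conjugate\<close>, the remaining
  parts by the induction hypothesis, and the two bijections are glued.
\<close>

lemma cyclic_type_eq_imp_equivariant_bij:
  assumes "finite d" "w permutes d"
    and "finite d'" "w' permutes d'" "cyclic_type d' w' = cyclic_type d w"
  shows "\<exists>f. bij_betw f d d' \<and> (\<forall>x\<in>d. f (w x) = w' (f x))"
  using assms
proof (induction arbitrary: d' w' rule: permutes_cycle_induct)
  case empty
  then have "card d' = 0" using sum_mset_cyclic_type[of d' w'] by (simp add: cyclic_type_def)
  then show ?case using empty by (simp add: bij_betw_def)
next
  case (cycle a b u v)
  have ty: "cyclic_type d' w' = add_mset (card b) (cyclic_type a u)"
    using cycle.prems(3) cycle.hyps
    by (metis add_mset_add_single cyclic_type_cycle cyclic_type_disjoint_comp)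
  then have "card b \<in># cyclic_type d' w'" by simp
  then obtain x where x: "x \<in> d'" "card (orbit w' x) = card b"
    using \<open>finite d'\<close> by (auto simp: cyclic_type_def)
  obtain a' u' v' where s: "a' \<inter> orbit w' x = {}" "d' = a' \<union> orbit w' x" "w' = u' \<circ> v'" "u' permutes a'"
      "v' permutes orbit w' x" "cyclic_on v' (orbit w' x)" "finite a'" "finite (orbit w' x)"
    using split_off_orbit[OF \<open>w' permutes d'\<close> \<open>finite d'\<close> x(1)] by metis
  define b' where "b' = orbit w' x"
  note s = s[folded b'_def]
  have "cyclic_type d' w' = cyclic_type a' u' + cyclic_type b' v'"
    unfolding s(2,3) by (rule cyclic_type_disjoint_comp) (use s in auto)
  then have "cyclic_type a' u' = cyclic_type a u"
    using ty x(2) s(6) by (simp add: cyclic_type_cycle b'_def)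
  then obtain f where f: "bij_betw f a a'" "\<forall>x\<in>a. f (u x) = u' (f x)"
    using cycle.IH s by metis
  obtain g where g: "bij_betw g b b'" "\<forall>x\<in>b. g (v x) = v' (g x)"
    using cycles_conjugate[OF cycle.hyps(6) s(6)] x(2) by (auto simp: b'_def)
  define k where "k = (\<lambda>x. if x \<in> a then f x else g x)"
  have ka: "bij_betw k a a'" using f(1) by (subst bij_betw_cong[of a k f]) (auto simp: k_def)
  have kb: "bij_betw k b b'" using g(1) cycle.hyps(3)
    by (subst bij_betw_cong[of b k g]) (auto simp: k_def)
  have "bij_betw k (a \<union> b) (a' \<union> b')" by (rule bij_betw_combine[OF ka kb s(1)])
  moreover have "k ((u \<circ> v) y) = w' (k y)" if "y \<in> a \<union> b" for y
  proof (cases "y \<in> a")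
    case True
    then have 1: "y \<notin> b" using cycle.hyps(3) by blast
    have 2: "f y \<in> a'" using f(1) True by (auto simp: bij_betw_def)
    then have 3: "f y \<notin> b'" using s(1) by blast
    have 4: "u y \<in> a" using True cycle.hyps(4) by (simp add: permutes_in_image)
    show ?thesis
      using True 4 f(2) permutes_not_in[OF cycle.hyps(5) 1] permutes_not_in[OF s(5) 3]
      by (simp add: k_def s(3))
  next
    case False
    then have yb: "y \<in> b" using that by blast
    have 1: "v y \<in> b" using yb cycle.hyps(5) by (simp add: permutes_in_image)
    then have 2: "v y \<notin> a" using cycle.hyps(3) by blast
    have "g (v y) \<in> b'" using g(1) 1 by (auto simp: bij_betw_def)
    then have 3: "g (v y) \<notin> a'" using s(1) by blast
    then have 4: "v' (g y) \<notin> a'" using g(2) yb by simp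
    show ?thesis
      using False yb 2 g(2) permutes_not_in[OF cycle.hyps(4) 2] permutes_not_in[OF s(4) 4]
      by (simp add: k_def s(3))
  qed
  ultimately show ?case using s(2) by blast
qed

text \<open>
  Since \<open>d\<close> and \<open>d'\<close> have equally many elements, so do \<open>d' - d\<close> and \<open>d - d'\<close>. Thus a bijection between
  the supports of two finite permutations extends to a permutation that moves only points of these
  supports, in particular not the excluded point \<open>0\<close>.
\<close>

lemma bij_betw_extend_permutes:
  assumes "finite d" "finite d'" "bij_betw f d d'"
  shows "\<exists>\<sigma>. \<sigma> permutes (d \<union> d') \<and> (\<forall>x\<in>d. \<sigma> x = f x)"
proof -
  have "card d = card d'" using assms by (simp add: bij_betw_same_card)
  then have "card (d' - d) = card (d - d')"
    using assms(1,2) by (simp add: card_Diff_subset_Int Int_commute)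
  then obtain g where g: "bij_betw g (d' - d) (d - d')"
    using assms(1,2) by (meson finite_Diff finite_same_card_bij)
  define \<sigma> where "\<sigma> = (\<lambda>x. if x \<in> d then f x else if x \<in> d' then g x else x)"
  have 1: "bij_betw \<sigma> d d'" using assms(3) by (subst bij_betw_cong[of d \<sigma> f]) (auto simp: \<sigma>_def)
  have 2: "bij_betw \<sigma> (d' - d) (d - d')" using g
    by (subst bij_betw_cong[of "d' - d" \<sigma> g]) (auto simp: \<sigma>_def)
  have "bij_betw \<sigma> (d \<union> (d' - d)) (d' \<union> (d - d'))"
    by (rule bij_betw_combine[OF 1 2]) blast
  then have "bij_betw \<sigma> (d \<union> d') (d \<union> d')" by (simp add: Un_commute)
  then have "\<sigma> permutes (d \<union> d')" by (rule bij_imp_permutes) (auto simp: \<sigma>_def)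
  then show ?thesis by (auto simp: \<sigma>_def)
qed

lemma cyclic_type_eq_imp_conjugate:
  assumes "finite d" "w permutes d" "finite d'" "w' permutes d'" "cyclic_type d w = cyclic_type d' w'"
  obtains \<sigma> where "\<sigma> permutes (d \<union> d')" "\<sigma> ` d = d'" "\<sigma> \<circ> w \<circ> inv \<sigma> = w'"
proof -
  obtain f where f: "bij_betw f d d'" "\<forall>x\<in>d. f (w x) = w' (f x)"
    using cyclic_type_eq_imp_equivariant_bij[OF assms(1-4)] assms(5) by metis
  obtain \<sigma> where \<sigma>: "\<sigma> permutes (d \<union> d')" "\<forall>x\<in>d. \<sigma> x = f x"
    using bij_betw_extend_permutes[OF assms(1,3) f(1)] by blast
  have im: "\<sigma> ` d = d'" using \<sigma>(2) f(1) by (auto simp: bij_betw_def)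
  have "\<sigma> (w x) = w' (\<sigma> x)" for x
  proof (cases "x \<in> d")
    case True
    then show ?thesis using \<sigma>(2) f(2) assms(2) by (simp add: permutes_in_image)
  next
    case False
    have "\<sigma> x \<notin> d'"
      using False permutes_inj[OF \<sigma>(1)] by (auto simp: im[symmetric] dest: injD)
    then show ?thesis using False assms(2,4) by (simp add: permutes_not_in)
  qed
  then have "\<sigma> \<circ> w = w' \<circ> \<sigma>" by auto
  then have "\<sigma> \<circ> w \<circ> inv \<sigma> = w'" using permutes_inv_o(1)[OF \<sigma>(1)] by (simp add: comp_assoc)
  then show ?thesis using that \<sigma>(1) im by blast
qed

lemma cyclic_type_conjugate:
  assumes "\<sigma> permutes S" "finite d" "w permutes d"
  shows "cyclic_type (\<sigma> ` d) (\<sigma> \<circ> w \<circ> inv \<sigma>) = cyclic_type d w"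
proof -
  have inj: "inj \<sigma>" using assms(1) by (rule permutes_inj)
  have "\<sigma> ` orbit w x = orbit (\<sigma> \<circ> w \<circ> inv \<sigma>) (\<sigma> x)" for x
  proof (rule orbit_inverse)
    show "x \<in> orbit w x"
        using assms(2,3) by (metis permutation_permutes permutation_self_in_orbit)
    show "(\<sigma> \<circ> w \<circ> inv \<sigma>) (\<sigma> y) = \<sigma> (w y)" for y
      using inj by simp
  qed
  then have "orbit (\<sigma> \<circ> w \<circ> inv \<sigma>) ` \<sigma> ` d = image \<sigma> ` orbit w ` d"
    by (simp add: image_image)
  moreover have "mset_set (image \<sigma> ` orbit w ` d) = image_mset (image \<sigma>) (mset_set (orbit w ` d))"
    by (rule image_mset_mset_set[symmetric]) (use inj in \<open>auto simp: inj_image_eq_iff intro!: inj_onI\<close>)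
  moreover have "card (\<sigma> ` X) = card X" for X
    using inj by (simp add: card_image inj_on_subset)
  ultimately show ?thesis
    by (simp add: cyclic_type_def image_mset.compositionality comp_def)
qed

section \<open>Class functions on finite permutations\<close>

lemma sum_fun_apply: "(\<Sum>i\<in>I. f i) b = (\<Sum>i\<in>I. f i b)" for f :: "'i \<Rightarrow> 'b \<Rightarrow> complex"
  by (induction I rule: infinite_finite_induct) auto

lemma lin_ext_apply:
  assumes "finite S" "{a. x a \<noteq> 0} \<subseteq> S"
  shows "lin_ext f x b = (\<Sum>a\<in>S. x a * f a b)"
proof -
  have "lin_ext f x b = (\<Sum>a\<in>{a. x a \<noteq> 0}. x a * f a b)"
    by (simp add: lin_ext_def sum_fun_apply fscale_def)
  also have "\<dots> = (\<Sum>a\<in>S. x a * f a b)"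
    by (rule sum.mono_neutral_left) (use assms in auto)
  finally show ?thesis .
qed

lemma bilin_ext_apply:
  assumes "finite S" "{a. x a \<noteq> 0} \<subseteq> S" "finite T" "{b. y b \<noteq> 0} \<subseteq> T"
  shows "bilin_ext f x y c = (\<Sum>a\<in>S. \<Sum>b\<in>T. x a * (y b * f a b c))"
  unfolding bilin_ext_def
  by (simp add: lin_ext_apply[OF assms(1,2)] lin_ext_apply[OF assms(3,4)] sum_distrib_left)

text \<open>
  The formal sums that are constant on cyclic types. On \<^const>\<open>A_circ_inf\<close> this map is
  \<^const>\<open>G_inf_map\<close>; the closed formula replaces the sum over diagrams in all computations.
\<close>

definition class_fun :: "(nat multiset \<Rightarrow> complex) \<Rightarrow> nat set \<times> (nat \<Rightarrow> nat) \<Rightarrow> complex" where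
  "class_fun a p = (if p \<in> finite_perms then a (cyclic_type (fst p) (snd p)) else 0)"

lemma mem_finite_perms_iff:
  "p \<in> finite_perms \<longleftrightarrow> finite (fst p) \<and> fst p \<noteq> {} \<and> 0 \<notin> fst p \<and> snd p permutes fst p"
  by (simp add: finite_perms_def case_prod_beta)

lemma mem_finite_perm_factors_iff:
  "t \<in> finite_perm_factors p \<longleftrightarrow>
     fst t \<in> finite_perms \<and> snd t \<in> finite_perms \<and> finite_perm_mult (fst t) (snd t) = p"
  by (simp add: finite_perm_factors_def case_prod_beta)

lemma cyclic_type_in_young_diagrams:
  "p \<in> finite_perms \<Longrightarrow> cyclic_type (fst p) (snd p) \<in> young_diagrams"
  using cyclic_type_in_young_of_degree[of "fst p" "snd p"]
  by (simp add: mem_finite_perms_iff young_of_degree_def)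

lemma sum_mset_cyclic_type_finite_perm:
  "p \<in> finite_perms \<Longrightarrow> sum_mset (cyclic_type (fst p) (snd p)) = card (fst p)"
  by (auto simp: finite_perms_def sum_mset_cyclic_type)

lemma ex_finite_perm_of_cyclic_type:
  assumes "\<Delta> \<in> young_diagrams"
  shows "\<exists>p\<in>finite_perms. cyclic_type (fst p) (snd p) = \<Delta>"
proof -
  have D: "\<Delta> \<noteq> {#}" "0 \<notin># \<Delta>" using assms by (auto simp: young_diagrams_def)
  then obtain w where w: "w permutes {1..sum_mset \<Delta>}" "cyclic_type {1..sum_mset \<Delta>} w = \<Delta>"
    using ex_permutation_of_cyclic_type[of "{1..sum_mset \<Delta>}" \<Delta>] by auto
  have "{1..sum_mset \<Delta>} \<noteq> {}"
  proof
    assume e: "{1..sum_mset \<Delta>} = {}"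
    show False using w(2) D unfolding e by (simp add: cyclic_type_def)
  qed
  then have "({1..sum_mset \<Delta>}, w) \<in> finite_perms" using w by (simp add: finite_perms_def)
  then show ?thesis using w(2) by force
qed

lemma G_inf_eq_class_fun: "G_inf \<Delta> = class_fun (indicator {\<Delta>})"
  by (auto simp: G_inf_def class_fun_def indicator_def fun_eq_iff)

lemma G_inf_map_eq_class_fun:
  assumes "a \<in> A_circ_inf"
  shows "G_inf_map a = class_fun a"
proof
  fix p
  let ?S = "{\<Delta>. a \<Delta> \<noteq> 0}"
  have fin: "finite ?S" using assms by (simp add: A_circ_inf_def)
  have "G_inf_map a p = (\<Sum>\<Delta>\<in>?S. a \<Delta> * G_inf \<Delta> p)"
    unfolding G_inf_map_def by (rule lin_ext_apply) (use fin in auto)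
  also have "\<dots> = class_fun a p"
  proof (cases "p \<in> finite_perms")
    case True
    let ?t = "cyclic_type (fst p) (snd p)"
    have "(\<Sum>\<Delta>\<in>?S. a \<Delta> * G_inf \<Delta> p) = (\<Sum>\<Delta>\<in>?S. if \<Delta> = ?t then a \<Delta> else 0)"
      by (rule sum.cong) (use True in \<open>auto simp: G_inf_eq_class_fun class_fun_def\<close>)
    then show ?thesis using True fin by (simp add: class_fun_def)
  qed (simp add: G_inf_eq_class_fun class_fun_def)
  finally show "G_inf_map a p = class_fun a p" .
qed

text \<open>
  A function on diagrams is recovered from its class function, because every diagram is the type of
  some finite permutation.
\<close>

lemma class_fun_inj:
  assumes "a \<in> A_circ_inf" "b \<in> A_circ_inf" "class_fun a = class_fun b"
  shows "a = b"
proof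
  fix \<Delta>
  show "a \<Delta> = b \<Delta>"
  proof (cases "\<Delta> \<in> young_diagrams")
    case True
    then obtain p where "p \<in> finite_perms" "cyclic_type (fst p) (snd p) = \<Delta>"
      using ex_finite_perm_of_cyclic_type by blast
    then show ?thesis using fun_cong[OF assms(3), of p] by (simp add: class_fun_def)
  next
    case False
    then have "a \<Delta> = 0" "b \<Delta> = 0" using assms(1,2) unfolding A_circ_inf_def by blast+
    then show ?thesis by simp
  qed
qed

lemma class_fun_add: "class_fun (a + b) = class_fun a + class_fun b"
  by (auto simp: class_fun_def)

lemma class_fun_scale: "class_fun (fscale c a) = fscale c (class_fun a)"
  by (auto simp: class_fun_def fscale_def)

lemma subspace_A_circ_inf: "fun_space.subspace A_circ_inf"
proof (rule fun_space.subspaceI)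
  show "0 \<in> A_circ_inf" by (simp add: A_circ_inf_def)
next
  fix x y assume xy: "x \<in> A_circ_inf" "y \<in> A_circ_inf"
  have "{\<Delta>. (x + y) \<Delta> \<noteq> 0} \<subseteq> {\<Delta>. x \<Delta> \<noteq> 0} \<union> {\<Delta>. y \<Delta> \<noteq> 0}" by auto
  then show "x + y \<in> A_circ_inf"
    using xy unfolding A_circ_inf_def by (blast intro: finite_subset)
next
  fix c x assume x: "x \<in> A_circ_inf"
  have "{\<Delta>. fscale c x \<Delta> \<noteq> 0} \<subseteq> {\<Delta>. x \<Delta> \<noteq> 0}" by (auto simp: fscale_def)
  then show "fscale c x \<in> A_circ_inf"
    using x unfolding A_circ_inf_def by (blast intro: finite_subset)
qed

lemma indicator_in_A_circ_inf: "\<Delta> \<in> young_diagrams \<Longrightarrow> indicator {\<Delta>} \<in> A_circ_inf"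
  by (auto simp: A_circ_inf_def indicator_def)

lemma A_inf_eq_image: "A_inf = class_fun ` A_circ_inf"
proof
  have "fun_space.subspace (class_fun ` A_circ_inf)"
  proof (rule fun_space.subspaceI)
    have "class_fun 0 = 0" by (auto simp: class_fun_def)
    then show "0 \<in> class_fun ` A_circ_inf"
      using fun_space.subspace_0[OF subspace_A_circ_inf] by (metis imageI)
  next
    fix x y assume "x \<in> class_fun ` A_circ_inf" "y \<in> class_fun ` A_circ_inf"
    then show "x + y \<in> class_fun ` A_circ_inf"
      using fun_space.subspace_add[OF subspace_A_circ_inf] class_fun_add by (smt (verit) imageE imageI)
  next
    fix c x assume "x \<in> class_fun ` A_circ_inf"
    then show "fscale c x \<in> class_fun ` A_circ_inf"
      using fun_space.subspace_scale[OF subspace_A_circ_inf] class_fun_scale by (smt (verit) imageE imageI)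
  qed
  moreover have "G_inf ` young_diagrams \<subseteq> class_fun ` A_circ_inf"
    by (auto simp: G_inf_eq_class_fun intro!: imageI indicator_in_A_circ_inf)
  ultimately show "A_inf \<subseteq> class_fun ` A_circ_inf"
    unfolding A_inf_def by (simp add: fun_space.span_minimal)
next
  show "class_fun ` A_circ_inf \<subseteq> A_inf"
  proof
    fix f assume "f \<in> class_fun ` A_circ_inf"
    then obtain a where a: "a \<in> A_circ_inf" "f = G_inf_map a" using G_inf_map_eq_class_fun by auto
    then have "f = (\<Sum>\<Delta>\<in>{\<Delta>. a \<Delta> \<noteq> 0}. fscale (a \<Delta>) (G_inf \<Delta>))"
      by (simp add: G_inf_map_def lin_ext_def)
    also have "\<dots> \<in> A_inf"
      unfolding A_inf_def
      by (intro fun_space.span_sum fun_space.span_scale fun_space.span_base)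
        (use a(1) in \<open>auto simp: A_circ_inf_def\<close>)
    finally show "f \<in> A_inf" .
  qed
qed

section \<open>Multiplication of formal sums of finite permutations\<close>

lemma finite_perm_mult_closed:
  assumes "p \<in> finite_perms" "q \<in> finite_perms"
  shows "finite_perm_mult p q \<in> finite_perms"
proof -
  have "snd p permutes fst p \<union> fst q" "snd q permutes fst p \<union> fst q"
    using assms by (auto simp: finite_perms_def intro: permutes_subset)
  then show ?thesis using assms
    by (auto simp: finite_perms_def finite_perm_mult_def permutes_compose)
qed

lemma finite_perm_mult_assoc:
  "finite_perm_mult (finite_perm_mult p q) r = finite_perm_mult p (finite_perm_mult q r)"
  by (simp add: finite_perm_mult_def Un_assoc comp_assoc)

lemma A_inf_mult_apply:
  "A_inf_mult x y p = (\<Sum>t\<in>finite_perm_factors p. x (fst t) * y (snd t))"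
  by (simp add: A_inf_mult_def case_prod_beta)

lemma A_inf_mult_outside:
  assumes "p \<notin> finite_perms"
  shows "A_inf_mult x y p = 0"
proof -
  have "finite_perm_factors p = {}"
    using assms finite_perm_mult_closed by (auto simp: finite_perm_factors_def)
  then show ?thesis by (simp add: A_inf_mult_apply)
qed

text \<open>
  Both sides sum over the factorizations of \<open>p\<close> into three finite permutations.
\<close>

lemma A_inf_mult_assoc:
  "A_inf_mult (A_inf_mult x y) z = A_inf_mult x (A_inf_mult y z)"
proof
  fix p
  let ?F = finite_perm_factors
  let ?L = "Sigma (?F p) (\<lambda>t. ?F (fst t))" and ?R = "Sigma (?F p) (\<lambda>t. ?F (snd t))"
  have fin: "finite (?F q)" for q by (rule finite_finite_perm_factors)
  have "A_inf_mult (A_inf_mult x y) z p =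
      (\<Sum>(t, s)\<in>?L. x (fst s) * y (snd s) * z (snd t))"
    by (simp add: A_inf_mult_apply sum_distrib_right sum.Sigma fin)
  also have "\<dots> = (\<Sum>(t, s)\<in>?R. x (fst t) * (y (fst s) * z (snd s)))"
    by (rule sum.reindex_bij_witness[where
          i = "\<lambda>(t, s). ((finite_perm_mult (fst t) (fst s), snd s), (fst t, fst s))" and
          j = "\<lambda>(t, s). ((fst s, finite_perm_mult (snd s) (snd t)), (snd s, snd t))"])
      (auto simp: mem_finite_perm_factors_iff mult.assoc,
        (metis finite_perm_mult_assoc finite_perm_mult_closed)+)
  also have "\<dots> = A_inf_mult x (A_inf_mult y z) p"
    by (simp add: A_inf_mult_apply sum_distrib_left sum.Sigma fin)
  finally show "A_inf_mult (A_inf_mult x y) z p = A_inf_mult x (A_inf_mult y z) p" .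
qed

lemma A_inf_mult_add_left: "A_inf_mult (x + y) z = A_inf_mult x z + A_inf_mult y z"
  by (simp add: A_inf_mult_apply fun_eq_iff distrib_right sum.distrib)

lemma A_inf_mult_add_right: "A_inf_mult z (x + y) = A_inf_mult z x + A_inf_mult z y"
  by (simp add: A_inf_mult_apply fun_eq_iff distrib_left sum.distrib)

lemma A_inf_mult_scale_left: "A_inf_mult (fscale c x) y = fscale c (A_inf_mult x y)"
  by (simp add: A_inf_mult_apply fun_eq_iff fscale_def sum_distrib_left mult.assoc)

lemma A_inf_mult_scale_right: "A_inf_mult x (fscale c y) = fscale c (A_inf_mult x y)"
  by (simp add: A_inf_mult_apply fun_eq_iff fscale_def sum_distrib_left mult.left_commute)

lemma conjugate_permutes:
  assumes "bij \<sigma>" "w permutes d"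
  shows "\<sigma> \<circ> w \<circ> inv \<sigma> permutes \<sigma> ` d"
proof -
  have "bij (\<sigma> \<circ> w \<circ> inv \<sigma>)"
    using assms by (intro bij_comp bij_imp_bij_inv permutes_bij)
  moreover have "(\<sigma> \<circ> w \<circ> inv \<sigma>) x = x" if "x \<notin> \<sigma> ` d" for x
  proof -
    have "inv \<sigma> x \<notin> d" using that assms(1) by (metis bij_inv_eq_iff imageI)
    then show ?thesis using assms by (simp add: permutes_not_in bij_is_surj surj_f_inv_f)
  qed
  ultimately show ?thesis by (auto simp: permutes_def bij_iff)
qed

text \<open>
  The action of a bijection of the underlying points on finite permutations, by transport of structure.
\<close>

definition relabel :: "(nat \<Rightarrow> nat) \<Rightarrow> nat set \<times> (nat \<Rightarrow> nat) \<Rightarrow> nat set \<times> (nat \<Rightarrow> nat)" where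
  "relabel \<sigma> p = (\<sigma> ` fst p, \<sigma> \<circ> snd p \<circ> inv \<sigma>)"

lemma relabel_inv:
  assumes "bij \<sigma>"
  shows "relabel (inv \<sigma>) (relabel \<sigma> p) = p"
  using assms by (simp add: relabel_def image_comp comp_assoc bij_is_inj inv_inv_eq)
    (simp add: comp_assoc[symmetric] bij_is_inj)

lemma relabel_in_finite_perms:
  assumes "\<sigma> permutes S" "0 \<notin> S" "p \<in> finite_perms"
  shows "relabel \<sigma> p \<in> finite_perms"
proof -
  have "\<sigma> 0 = 0" using assms(1,2) by (simp add: permutes_not_in)
  then have "0 \<notin> \<sigma> ` fst p"
    using assms(3) permutes_inj[OF assms(1)] by (auto simp: finite_perms_def dest: injD)
      (metis injD)
  moreover have "\<sigma> \<circ> snd p \<circ> inv \<sigma> permutes \<sigma> ` fst p"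
    using assms by (intro conjugate_permutes) (auto simp: permutes_bij finite_perms_def)
  ultimately show ?thesis
    using assms(3) by (auto simp: relabel_def finite_perms_def)
qed

lemma relabel_mult:
  assumes "bij \<sigma>"
  shows "relabel \<sigma> (finite_perm_mult p q) = finite_perm_mult (relabel \<sigma> p) (relabel \<sigma> q)"
  using assms by (auto simp: relabel_def finite_perm_mult_def image_Un fun_eq_iff bij_is_inj)

lemma class_fun_relabel:
  assumes "\<sigma> permutes S" "0 \<notin> S" "p \<in> finite_perms"
  shows "class_fun a (relabel \<sigma> p) = class_fun a p"
proof -
  have "cyclic_type (fst (relabel \<sigma> p)) (snd (relabel \<sigma> p)) = cyclic_type (fst p) (snd p)"
    using assms(3) cyclic_type_conjugate[OF assms(1), of "fst p" "snd p"]
    by (auto simp: relabel_def finite_perms_def)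
  then show ?thesis using assms relabel_in_finite_perms[OF assms] by (simp add: class_fun_def)
qed

lemma A_inf_mult_class_fun_relabel:
  assumes \<sigma>: "\<sigma> permutes S" "0 \<notin> S"
  shows "A_inf_mult (class_fun a) (class_fun b) (relabel \<sigma> p) = A_inf_mult (class_fun a) (class_fun b) p"
proof -
  have bij: "bij \<sigma>" "bij (inv \<sigma>)" using \<sigma>(1) by (auto simp: permutes_bij bij_imp_bij_inv)
  have inv: "inv \<sigma> permutes S" using \<sigma>(1) by (rule permutes_inv)
  have inv2: "relabel \<sigma> (relabel (inv \<sigma>) q) = q" for q
    using relabel_inv[OF bij(2)] bij(1) by (simp add: inv_inv_eq)
  show ?thesis
    unfolding A_inf_mult_apply
    by (rule sum.reindex_bij_witness[where
          i = "\<lambda>t. (relabel \<sigma> (fst t), relabel \<sigma> (snd t))" and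
          j = "\<lambda>t. (relabel (inv \<sigma>) (fst t), relabel (inv \<sigma>) (snd t))"])
      (auto simp: mem_finite_perm_factors_iff relabel_inv[OF bij(1)] inv2
        relabel_in_finite_perms[OF \<sigma>] relabel_in_finite_perms[OF inv \<sigma>(2)]
        relabel_mult[OF bij(1), symmetric] relabel_mult[OF bij(2), symmetric]
        class_fun_relabel[OF inv \<sigma>(2)])
qed

text \<open>
  Relabelling permutes the factorizations and preserves the cyclic types of the factors, and finite
  permutations of equal type are relabellings of each other. So a product of class functions is again
  constant on cyclic types.
\<close>

lemma A_inf_mult_class_fun_eqI:
  assumes "p \<in> finite_perms" "q \<in> finite_perms"
    and "cyclic_type (fst p) (snd p) = cyclic_type (fst q) (snd q)"
  shows "A_inf_mult (class_fun a) (class_fun b) p = A_inf_mult (class_fun a) (class_fun b) q"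
proof -
  obtain \<sigma> where \<sigma>: "\<sigma> permutes (fst p \<union> fst q)" "\<sigma> ` fst p = fst q" "\<sigma> \<circ> snd p \<circ> inv \<sigma> = snd q"
    using cyclic_type_eq_imp_conjugate[of "fst p" "snd p" "fst q" "snd q"] assms
    unfolding mem_finite_perms_iff by metis
  have "relabel \<sigma> p = q" using \<sigma> by (simp add: relabel_def)
  moreover have "0 \<notin> fst p \<union> fst q" using assms by (auto simp: finite_perms_def)
  ultimately show ?thesis using A_inf_mult_class_fun_relabel[OF \<sigma>(1)] by metis
qed

text \<open>
  The structure constants of the algebra of formal sums: \<open>c\<close> takes the value of the product at any
  finite permutation of the given type. The support of a product is the union of the supports of the
  factors, whence the bounds on the degree, and these bounds make \<open>c\<close> finitely supported.
\<close>

lemma G_inf_mult_eq_class_fun: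
  obtains c where "c \<in> A_circ_inf" "A_inf_mult (G_inf \<Delta>1) (G_inf \<Delta>2) = class_fun c"
    "\<And>\<Delta>. c \<Delta> \<noteq> 0 \<Longrightarrow> max_degree \<Delta>1 \<Delta>2 \<le> sum_mset \<Delta> \<and> sum_mset \<Delta> \<le> sum_mset \<Delta>1 + sum_mset \<Delta>2"
proof -
  define P where "P = A_inf_mult (G_inf \<Delta>1) (G_inf \<Delta>2)"
  define r where "r \<Delta> = (SOME p. p \<in> finite_perms \<and> cyclic_type (fst p) (snd p) = \<Delta>)" for \<Delta>
  define c where "c \<Delta> = (if \<Delta> \<in> young_diagrams then P (r \<Delta>) else 0)" for \<Delta>
  have "r \<Delta> \<in> finite_perms \<and> cyclic_type (fst (r \<Delta>)) (snd (r \<Delta>)) = \<Delta>"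
    if "\<Delta> \<in> young_diagrams" for \<Delta>
    unfolding r_def by (rule someI_ex) (use ex_finite_perm_of_cyclic_type[OF that] in blast)
  then have r: "r \<Delta> \<in> finite_perms" "cyclic_type (fst (r \<Delta>)) (snd (r \<Delta>)) = \<Delta>"
    if "\<Delta> \<in> young_diagrams" for \<Delta>
    using that by blast+
  have Pc: "P = class_fun c"
  proof
    fix p
    show "P p = class_fun c p"
    proof (cases "p \<in> finite_perms")
      case True
      let ?\<Delta> = "cyclic_type (fst p) (snd p)"
      have "?\<Delta> \<in> young_diagrams" by (rule cyclic_type_in_young_diagrams[OF True])
      moreover have "P p = P (r ?\<Delta>)"
        unfolding P_def G_inf_eq_class_fun
        by (rule A_inf_mult_class_fun_eqI) (use True r calculation in auto)
      ultimately show ?thesis using True by (simp add: class_fun_def c_def)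
    next
      case False
      then show ?thesis by (simp add: P_def A_inf_mult_outside class_fun_def)
    qed
  qed
  have deg: "max_degree \<Delta>1 \<Delta>2 \<le> sum_mset \<Delta> \<and> sum_mset \<Delta> \<le> sum_mset \<Delta>1 + sum_mset \<Delta>2"
    if nz: "c \<Delta> \<noteq> 0" for \<Delta>
  proof -
    have \<Delta>: "\<Delta> \<in> young_diagrams" "P (r \<Delta>) \<noteq> 0" using nz by (auto simp: c_def split: if_splits)
    then obtain t where t: "t \<in> finite_perm_factors (r \<Delta>)"
      "G_inf \<Delta>1 (fst t) \<noteq> 0" "G_inf \<Delta>2 (snd t) \<noteq> 0"
      unfolding P_def A_inf_mult_apply by (metis (no_types, lifting) mult_eq_0_iff sum.neutral)
    have "card (fst (fst t)) = sum_mset \<Delta>1" "card (fst (snd t)) = sum_mset \<Delta>2"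
      using t(2,3) by (auto simp: G_inf_def indicator_def finite_perms_def sum_mset_cyclic_type split: if_splits)
    moreover have "card (fst (r \<Delta>)) = sum_mset \<Delta>"
      using sum_mset_cyclic_type_finite_perm[OF r(1)[OF \<Delta>(1)]] r(2)[OF \<Delta>(1)] by simp
    moreover have "fst (r \<Delta>) = fst (fst t) \<union> fst (snd t)"
      using t(1) unfolding mem_finite_perm_factors_iff finite_perm_mult_def by (metis fst_conv)
    moreover have "finite (fst (fst t))" "finite (fst (snd t))"
      using t(1) unfolding mem_finite_perm_factors_iff mem_finite_perms_iff by blast+
    ultimately show ?thesis
      by (metis card_Un_le card_mono finite_Un max.bounded_iff sup_ge1 sup_ge2)
  qed
  have "{\<Delta>. c \<Delta> \<noteq> 0} \<subseteq> (\<Union>n\<le>sum_mset \<Delta>1 + sum_mset \<Delta>2. young_of_degree n)"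
    using deg by (auto simp: young_of_degree_def c_def split: if_splits)
  then have "finite {\<Delta>. c \<Delta> \<noteq> 0}"
    by (rule finite_subset) (simp add: finite_young_of_degree)
  then have "c \<in> A_circ_inf" by (auto simp: A_circ_inf_def c_def)
  then show ?thesis using that[of c] Pc deg unfolding P_def by blast
qed

section \<open>Evaluation in the group algebra of a symmetric group\<close>

text \<open>
  A product of two linear combinations, summed over \<open>t\<close>, is the bilinear combination of the
  elementary products; it serves both for formal sums and for group algebras, where \<open>t\<close> ranges over
  factorizations.
\<close>

lemma sum_product_bilinear:
  fixes f g :: "'i \<Rightarrow> 't \<Rightarrow> complex"
  shows "(\<Sum>t\<in>T. (\<Sum>i\<in>I. x i * f i t) * (\<Sum>j\<in>J. y j * g j t)) =
    (\<Sum>i\<in>I. \<Sum>j\<in>J. x i * (y j * (\<Sum>t\<in>T. f i t * g j t)))"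
proof -
  have "(\<Sum>t\<in>T. (\<Sum>i\<in>I. x i * f i t) * (\<Sum>j\<in>J. y j * g j t)) =
      (\<Sum>t\<in>T. \<Sum>i\<in>I. \<Sum>j\<in>J. x i * (y j * (f i t * g j t)))"
    by (simp add: sum_product ac_simps)
  also have "\<dots> = (\<Sum>i\<in>I. \<Sum>t\<in>T. \<Sum>j\<in>J. x i * (y j * (f i t * g j t)))"
    by (rule sum.swap)
  also have "\<dots> = (\<Sum>i\<in>I. \<Sum>j\<in>J. \<Sum>t\<in>T. x i * (y j * (f i t * g j t)))"
    by (intro sum.cong refl sum.swap)
  finally show ?thesis by (simp add: sum_distrib_left)
qed

definition perm_factors :: "nat \<Rightarrow> (nat \<Rightarrow> nat) \<Rightarrow> ((nat \<Rightarrow> nat) \<times> (nat \<Rightarrow> nat)) set" where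
  "perm_factors n w = {(u, v). u permutes {1..n} \<and> v permutes {1..n} \<and> u \<circ> v = w}"

lemma mem_perm_factors_iff:
  "t \<in> perm_factors n w \<longleftrightarrow> fst t permutes {1..n} \<and> snd t permutes {1..n} \<and> fst t \<circ> snd t = w"
  by (simp add: perm_factors_def case_prod_beta)

lemma group_algebra_mult_apply:
  "group_algebra_mult n x y w = (\<Sum>t\<in>perm_factors n w. x (fst t) * y (snd t))"
  unfolding group_algebra_mult_def perm_factors_def by (rule sum.cong) auto

lemma finite_perm_factors_symmetric: "finite (perm_factors n w)"
  by (rule finite_subset[of _ "{u. u permutes {1..n}} \<times> {u. u permutes {1..n}}"])
    (auto simp: perm_factors_def finite_permutations)

text \<open>
  The map induced by \<open>(d, w) \<mapsto> w\<close> from formal sums to the group algebra of the symmetric group on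
  \<open>{1..n}\<close>, where finite permutations with \<open>d\<close> not contained in \<open>{1..n}\<close> are sent to \<open>0\<close>.
\<close>

definition perm_eval :: "nat \<Rightarrow> (nat set \<times> (nat \<Rightarrow> nat) \<Rightarrow> complex) \<Rightarrow> (nat \<Rightarrow> nat) \<Rightarrow> complex" where
  "perm_eval n x w = (\<Sum>d\<in>Pow {1..n}. x (d, w))"

text \<open>
  Evaluation is multiplicative because a union of two sets lies in \<open>{1..n}\<close> exactly if both sets do:
  giving \<open>d \<subseteq> {1..n}\<close> and a factorization of \<open>(d, w)\<close> amounts to giving a factorization \<open>w = u \<circ> v\<close> and
  two subsets of \<open>{1..n}\<close> on which \<open>u\<close> and \<open>v\<close> live.
\<close>

lemma perm_eval_mult:
  assumes x: "\<And>p. p \<notin> finite_perms \<Longrightarrow> x p = 0" and y: "\<And>p. p \<notin> finite_perms \<Longrightarrow> y p = 0"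
  shows "perm_eval n (A_inf_mult x y) = group_algebra_mult n (perm_eval n x) (perm_eval n y)"
proof
  fix w
  let ?N = "Pow {1..n}"
  let ?S = "perm_factors n w \<times> (?N \<times> ?N)"
  let ?T = "SIGMA d:?N. finite_perm_factors (d, w)"
  let ?S' = "{r \<in> ?S. (fst (snd r), fst (fst r)) \<notin> finite_perms \<or> (snd (snd r), snd (fst r)) \<notin> finite_perms}"
  define i :: "nat set \<times> (nat set \<times> (nat \<Rightarrow> nat)) \<times> nat set \<times> (nat \<Rightarrow> nat) \<Rightarrow> _" where
    "i = (\<lambda>(_, (d1, u), (d2, v)). ((u, v), (d1, d2)))"
  define j :: "((nat \<Rightarrow> nat) \<times> (nat \<Rightarrow> nat)) \<times> nat set \<times> nat set \<Rightarrow> _" where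
    "j = (\<lambda>((u, v), (d1, d2)). (d1 \<union> d2, ((d1, u), (d2, v))))"
  have finS: "finite ?S" by (simp add: finite_perm_factors_symmetric)
  \<comment> \<open>In \<open>?S\<close> the subsets are arbitrary; the terms in \<open>?S'\<close>, where a subset does not support its
    permutation, vanish.\<close>
  have "group_algebra_mult n (perm_eval n x) (perm_eval n y) w =
      (\<Sum>r\<in>?S. x (fst (snd r), fst (fst r)) * y (snd (snd r), snd (fst r)))"
    by (simp add: group_algebra_mult_apply perm_eval_def sum_product sum.cartesian_product
        case_prod_beta sum.Sigma[symmetric])
  also have "\<dots> = (\<Sum>r\<in>?T. x (fst (snd r)) * y (snd (snd r)))"
  proof (rule sum.reindex_bij_witness_not_neutral[where S' = ?S' and T' = "{}" and i = i and j = j])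
    show "finite ?S'" using finS by simp
  next
    fix r assume r: "r \<in> ?T - {}"
    obtain d d1 u d2 v where req: "r = (d, (d1, u), (d2, v))" by (metis surj_pair)
    then have *: "d \<subseteq> {1..n}" "d = d1 \<union> d2" "w = u \<circ> v"
        "(d1, u) \<in> finite_perms" "(d2, v) \<in> finite_perms"
      using r by (auto simp: mem_finite_perm_factors_iff finite_perm_mult_def)
    show "j (i r) = r" using * by (simp add: req i_def j_def)
    have "u permutes {1..n}" "v permutes {1..n}"
      using * permutes_subset[of u d1 "{1..n}"] permutes_subset[of v d2 "{1..n}"]
      by (auto simp: mem_finite_perms_iff)
    then show "i r \<in> ?S - ?S'"
      using * by (auto simp: req i_def mem_perm_factors_iff)
  next
    fix r assume r: "r \<in> ?S - ?S'"
    obtain u v d1 d2 where req: "r = ((u, v), (d1, d2))" by (metis surj_pair)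
    then show "j r \<in> ?T - {}" "i (j r) = r" using r
      by (auto simp: i_def j_def mem_finite_perm_factors_iff finite_perm_mult_def mem_perm_factors_iff)
  next
    show "x (fst (snd (j r))) * y (snd (snd (j r))) = x (fst (snd r), fst (fst r)) * y (snd (snd r), snd (fst r))"
      for r by (simp add: j_def case_prod_beta)
  qed (use x y in auto)
  also have "\<dots> = perm_eval n (A_inf_mult x y) w"
    by (simp add: perm_eval_def A_inf_mult_apply sum.Sigma finite_finite_perm_factors case_prod_beta)
  finally show "perm_eval n (A_inf_mult x y) w = group_algebra_mult n (perm_eval n x) (perm_eval n y) w"
    by simp
qed

lemma cyclic_type_remove_fixed_points:
  assumes "finite d" "w permutes d" "s \<subseteq> d" "\<And>x. x \<in> s \<Longrightarrow> w x = x"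
  shows "w permutes (d - s)" "cyclic_type d w = cyclic_type (d - s) w + replicate_mset (card s) 1"
proof -
  show p: "w permutes (d - s)" by (rule permutes_superset[OF assms(2)]) (use assms(4) in auto)
  have "finite s" using assms finite_subset by blast
  then have "cyclic_type (d - s \<union> s) (w \<circ> id) = cyclic_type (d - s) w + replicate_mset (card s) 1"
    using cyclic_type_disjoint_comp[of "d - s" s w id] assms(1) p cyclic_type_id[of s]
    by (simp add: permutes_id Int_commute)
  moreover have "d - s \<union> s = d" using assms(3) by blast
  ultimately show "cyclic_type d w = cyclic_type (d - s) w + replicate_mset (card s) 1" by simp
qed

lemma count_one_cyclic_type:
  assumes "finite d" "w permutes d"
  shows "count (cyclic_type d w) 1 = card {x \<in> d. w x = x}"
proof -
  let ?F = "{x \<in> d. w x = x}"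
  have "1 \<notin># cyclic_type (d - ?F) w"
  proof
    assume "1 \<in># cyclic_type (d - ?F) w"
    then obtain x where x: "x \<in> d - ?F" "card (orbit w x) = 1"
      using assms(1) unfolding cyclic_type_def by fastforce
    then obtain y where "orbit w x = {y}" by (auto simp: card_1_singleton_iff)
    moreover have "w x \<in> orbit w x" "w (w x) \<in> orbit w x" by (auto intro: orbit.intros)
    ultimately have "w (w x) = w x" by simp
    then have "w x = x" using permutes_inj[OF assms(2)] by (auto dest: injD)
    then show False using x by simp
  qed
  moreover have "cyclic_type d w = cyclic_type (d - ?F) w + replicate_mset (card ?F) 1"
    by (rule cyclic_type_remove_fixed_points(2)) (use assms in auto)
  ultimately show ?thesis by (simp add: not_in_iff)
qed

text \<open>
  A set \<open>d \<subseteq> {1..n}\<close> supports \<open>w\<close> exactly if its complement consists of fixed points of \<open>w\<close>. Removing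
  \<open>k\<close> fixed points removes \<open>k\<close> unit rows from the type, and the number of ways to choose them is the
  binomial coefficient in the number of fixed points, that is, of unit rows. The hypothesis on the
  empty multiset discards \<open>d = {}\<close>, which is not the support of a finite permutation.
\<close>

lemma perm_eval_class_fun:
  assumes "w permutes {1..n}" "a {#} = 0"
  shows "perm_eval n (class_fun a) w =
    (\<Sum>k\<le>n. of_nat (count (cyclic_type {1..n} w) 1 choose k) *
      a (cyclic_type {1..n} w - replicate_mset k 1))"
proof -
  let ?N = "{1..n}" and ?T = "cyclic_type {1..n} w"
  let ?F = "{x \<in> {1..n}. w x = x}"
  have "perm_eval n (class_fun a) w =
      (\<Sum>d\<in>{d. d \<subseteq> ?N \<and> w permutes d}. a (cyclic_type d w))"
    unfolding perm_eval_def
  proof (rule sum.mono_neutral_cong_right)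
    show "\<forall>d\<in>Pow ?N - {d. d \<subseteq> ?N \<and> w permutes d}. class_fun a (d, w) = 0"
      by (auto simp: class_fun_def mem_finite_perms_iff)
    show "class_fun a (d, w) = a (cyclic_type d w)" if "d \<in> {d. d \<subseteq> ?N \<and> w permutes d}" for d
    proof (cases "d = {}")
      case True
      then show ?thesis using assms(2) by (simp add: class_fun_def cyclic_type_def mem_finite_perms_iff)
    next
      case False
      then have "(d, w) \<in> finite_perms"
        using that finite_subset[of d ?N] by (auto simp: mem_finite_perms_iff)
      then show ?thesis by (simp add: class_fun_def)
    qed
  qed auto
  also have "\<dots> = (\<Sum>s\<in>Pow ?F. a (?T - replicate_mset (card s) 1))"
  proof (rule sum.reindex_bij_witness[where i = "\<lambda>s. ?N - s" and j = "\<lambda>d. ?N - d"])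
    fix s assume s: "s \<in> Pow ?F"
    then have "s \<subseteq> ?N" "\<And>x. x \<in> s \<Longrightarrow> w x = x" by auto
    then have "w permutes (?N - s)"
      by (intro cyclic_type_remove_fixed_points(1)[of ?N w s]) (use assms(1) in auto)
    then show "?N - s \<in> {d. d \<subseteq> ?N \<and> w permutes d}" by auto
  next
    fix d assume d: "d \<in> {d. d \<subseteq> ?N \<and> w permutes d}"
    then have fixed: "w x = x" if "x \<in> ?N - d" for x using that by (auto simp: permutes_not_in)
    then show "?N - d \<in> Pow ?F" by auto
    have "?T = cyclic_type (?N - (?N - d)) w + replicate_mset (card (?N - d)) 1"
      by (rule cyclic_type_remove_fixed_points(2)) (use assms(1) fixed in auto)
    moreover have "?N - (?N - d) = d" using d by auto
    ultimately show "a (?T - replicate_mset (card (?N - d)) 1) = a (cyclic_type d w)" by simp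
  qed auto
  also have "\<dots> = (\<Sum>k\<le>n. \<Sum>s\<in>{s. s \<in> Pow ?F \<and> card s = k}. a (?T - replicate_mset (card s) 1))"
  proof (rule sum.group[symmetric])
    show "card ` Pow ?F \<subseteq> {..n}"
    proof
      fix m assume "m \<in> card ` Pow ?F"
      then obtain s where "s \<subseteq> ?N" "m = card s" by blast
      then show "m \<in> {..n}" using card_mono[of ?N s] by simp
    qed
  qed auto
  also have "\<dots> = (\<Sum>k\<le>n. of_nat (count ?T 1 choose k) * a (?T - replicate_mset k 1))"
  proof (rule sum.cong[OF refl])
    fix k
    have "card {s. s \<in> Pow ?F \<and> card s = k} = card ?F choose k"
      using n_subsets[of ?F k] by simp
    then show "(\<Sum>s\<in>{s. s \<in> Pow ?F \<and> card s = k}. a (?T - replicate_mset (card s) 1)) =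
        of_nat (count ?T 1 choose k) * a (?T - replicate_mset k 1)"
      using count_one_cyclic_type[OF _ assms(1)] by simp
  qed
  finally show ?thesis .
qed

text \<open>
  The normalisation in \<^const>\<open>rho\<close> is the same binomial coefficient, since \<open>\<Delta>\<^sup>k\<close> has \<open>r + k\<close> unit rows if
  \<open>\<Delta>\<close> has \<open>r\<close>. This is why \<^const>\<open>rho\<close> describes evaluation on class functions.
\<close>

lemma rho_apply:
  assumes "finite {\<Delta>. x \<Delta> \<noteq> 0}"
  shows "rho k x T = of_nat (count T 1 choose k) * x (T - replicate_mset k 1)"
proof -
  let ?D = "T - replicate_mset k 1"
  let ?S = "insert ?D {\<Delta>. x \<Delta> \<noteq> 0}"
  let ?f = "\<lambda>\<Delta>. fscale (fact (count \<Delta> 1 + k) / (fact (count \<Delta> 1) * fact k))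
                    (indicator {add_unit_rows k \<Delta>}) T :: complex"
  have "rho k x T = (\<Sum>\<Delta>\<in>?S. x \<Delta> * ?f \<Delta>)"
    unfolding rho_def by (rule lin_ext_apply) (use assms in auto)
  also have "\<dots> = (\<Sum>\<Delta>\<in>{?D}. x \<Delta> * ?f \<Delta>)"
    by (rule sum.mono_neutral_right)
      (use assms in \<open>auto simp: fscale_def add_unit_rows_def indicator_def\<close>)
  also have "\<dots> = x ?D * ?f ?D" by simp
  also have "?f ?D = of_nat (count T 1 choose k)"
  proof (cases "k \<le> count T 1")
    case True
    then have "replicate_mset k 1 \<subseteq># T" by (simp add: count_le_replicate_mset_subset_eq)
    then have "add_unit_rows k ?D = T" by (simp add: add_unit_rows_def)
    then show ?thesis using True by (simp add: fscale_def binomial_fact mult.commute)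
  next
    case False
    have "T \<noteq> add_unit_rows k ?D"
    proof
      assume "T = add_unit_rows k ?D"
      then have "count T 1 = count (add_unit_rows k ?D) 1" by simp
      then show False using False by (simp add: add_unit_rows_def)
    qed
    then show ?thesis using False by (simp add: fscale_def binomial_eq_0)
  qed
  finally show ?thesis by simp
qed

lemma remove_unit_rows:
  fixes T :: "nat multiset"
  assumes "k \<le> count T 1"
  shows "T - replicate_mset k 1 + replicate_mset k 1 = T"
    "sum_mset (T - replicate_mset k 1) + k = sum_mset T"
proof -
  have "replicate_mset k 1 \<subseteq># T" using assms by (simp add: count_le_replicate_mset_subset_eq)
  then show *: "T - replicate_mset k 1 + replicate_mset k 1 = T" by simp
  have "sum_mset (T - replicate_mset k 1 + replicate_mset k 1) = sum_mset (T - replicate_mset k 1) + k"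
    by simp
  then show "sum_mset (T - replicate_mset k 1) + k = sum_mset T" using * by metis
qed

lemma young_of_degree_add_unit_rows:
  assumes "k \<le> count T 1" "T - replicate_mset k 1 \<in> young_of_degree m"
  shows "T \<in> young_of_degree (m + k)"
proof -
  have "set_mset T \<subseteq> set_mset (T - replicate_mset k 1) \<union> {1}"
    using remove_unit_rows(1)[OF assms(1)] by (metis Un_mono set_mset_replicate_mset_subset
        set_mset_union subset_refl empty_subsetI)
  then have "0 \<notin># T" using assms(2) by (auto simp: young_of_degree_def young_diagrams_def)
  moreover have "T \<noteq> {#}" using assms(2) by (auto simp: young_of_degree_def young_diagrams_def)
  ultimately show ?thesis
    using assms(2) remove_unit_rows(2)[OF assms(1)] by (simp add: young_of_degree_def young_diagrams_def)
qed

lemma young_of_degree_remove_unit_rows: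
  assumes "k \<le> count T 1" "T \<in> young_of_degree (m + k)" "m > 0"
  shows "T - replicate_mset k 1 \<in> young_of_degree m"
proof -
  have "sum_mset (T - replicate_mset k 1) = m"
    using remove_unit_rows(2)[OF assms(1)] assms(2) by (simp add: young_of_degree_def)
  moreover from this have "T - replicate_mset k 1 \<noteq> {#}" using assms(3) by auto
  moreover have "0 \<notin># T - replicate_mset k 1"
    using assms(2) by (auto simp: young_of_degree_def young_diagrams_def dest: in_diffD)
  ultimately show ?thesis by (simp add: young_of_degree_def young_diagrams_def)
qed

lemma finite_support_young_of_degree:
  assumes "\<And>\<Delta>. \<Delta> \<notin> young_of_degree n \<Longrightarrow> x \<Delta> = 0"
  shows "finite {\<Delta>. x \<Delta> \<noteq> (0 :: complex)}"
  by (rule finite_subset[OF _ finite_young_of_degree[of n]]) (use assms in blast)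

lemma rho_outside:
  assumes "\<And>\<Delta>. \<Delta> \<notin> young_of_degree m \<Longrightarrow> x \<Delta> = 0" "T \<notin> young_of_degree (m + k)"
  shows "rho k x T = 0"
proof (cases "k \<le> count T 1")
  case True
  then have "T - replicate_mset k 1 \<notin> young_of_degree m"
    using young_of_degree_add_unit_rows assms(2) by blast
  then show ?thesis
    using rho_apply[OF finite_support_young_of_degree[OF assms(1)]] assms(1) by simp
next
  case False
  then show ?thesis
    using rho_apply[OF finite_support_young_of_degree[OF assms(1)]] by (simp add: binomial_eq_0)
qed

section \<open>Products of class sums in a symmetric group\<close>

definition class_fun_fin :: "nat \<Rightarrow> (nat multiset \<Rightarrow> complex) \<Rightarrow> (nat \<Rightarrow> nat) \<Rightarrow> complex" where
  "class_fun_fin n a w = (if w permutes {1..n} then a (cyclic_type {1..n} w) else 0)"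

lemma cyclic_type_symmetric_group:
  assumes "n > 0" "w permutes {1..n}"
  shows "cyclic_type {1..n} w \<in> young_of_degree n"
  using cyclic_type_in_young_of_degree[of "{1..n}" w] assms by simp

lemma G_fin_eq_class_fun_fin: "G_fin n \<Delta> = class_fun_fin n (indicator {\<Delta>})"
  by (auto simp: G_fin_def class_fun_fin_def indicator_def fun_eq_iff)

lemma class_fun_fin_eq_sum:
  assumes "n > 0"
  shows "class_fun_fin n a w = (\<Sum>\<Delta>\<in>young_of_degree n. a \<Delta> * G_fin n \<Delta> w)"
proof (cases "w permutes {1..n}")
  case True
  let ?t = "cyclic_type {1..n} w"
  have "(\<Sum>\<Delta>\<in>young_of_degree n. a \<Delta> * G_fin n \<Delta> w) = (\<Sum>\<Delta>\<in>young_of_degree n. if \<Delta> = ?t then a \<Delta> else 0)"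
    by (rule sum.cong) (use True in \<open>auto simp: G_fin_eq_class_fun_fin class_fun_fin_def\<close>)
  then show ?thesis
    using True cyclic_type_symmetric_group[OF assms True]
    by (simp add: class_fun_fin_def finite_young_of_degree)
next
  case False
  then show ?thesis by (simp add: class_fun_fin_def G_fin_eq_class_fun_fin)
qed

lemma class_fun_fin_inj:
  assumes "class_fun_fin n a = class_fun_fin n b" "T \<in> young_of_degree n"
  shows "a T = b T"
proof -
  obtain w where w: "w permutes {1..n}" "cyclic_type {1..n} w = T"
    using ex_permutation_of_cyclic_type[of "{1..n}" T] assms(2)
    by (auto simp: young_of_degree_def young_diagrams_def)
  then show ?thesis using fun_cong[OF assms(1), of w] by (simp add: class_fun_fin_def)
qed

text \<open>
  If both factors have degree \<open>n\<close>, then every factorization of \<open>({1..n}, w)\<close> that contributes to the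
  product of formal sums has \<open>{1..n}\<close> as the support of both factors. Hence the fact that products of
  class sums are class functions is inherited from the algebra of formal sums.
\<close>

lemma group_algebra_mult_eq_A_inf_mult:
  assumes "n > 0" "w permutes {1..n}"
    and a: "\<And>\<Delta>. \<Delta> \<notin> young_of_degree n \<Longrightarrow> a \<Delta> = 0"
    and b: "\<And>\<Delta>. \<Delta> \<notin> young_of_degree n \<Longrightarrow> b \<Delta> = 0"
  shows "group_algebra_mult n (class_fun_fin n a) (class_fun_fin n b) w =
    A_inf_mult (class_fun a) (class_fun b) ({1..n}, w)"
proof -
  let ?N = "{1..n}"
  let ?F = "finite_perm_factors (?N, w)"
  let ?F' = "{t \<in> ?F. fst (fst t) = ?N \<and> fst (snd t) = ?N}"
  have vanish: "class_fun c p = 0"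
    if c: "\<And>\<Delta>. \<Delta> \<notin> young_of_degree n \<Longrightarrow> c \<Delta> = 0" and p: "fst p \<subseteq> ?N" "fst p \<noteq> ?N" for c p
  proof -
    have "card (fst p) < n" using psubset_card_mono[of ?N "fst p"] p by auto
    then have "cyclic_type (fst p) (snd p) \<notin> young_of_degree n" if "p \<in> finite_perms"
      using sum_mset_cyclic_type_finite_perm[OF that] by (simp add: young_of_degree_def)
    then show ?thesis using c by (simp add: class_fun_def)
  qed
  have "A_inf_mult (class_fun a) (class_fun b) (?N, w) =
      (\<Sum>t\<in>?F'. class_fun a (fst t) * class_fun b (snd t))"
    unfolding A_inf_mult_apply
  proof (rule sum.mono_neutral_right)
    show "\<forall>t\<in>?F - ?F'. class_fun a (fst t) * class_fun b (snd t) = 0"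
    proof
      fix t assume t: "t \<in> ?F - ?F'"
      then have "fst (fst t) \<union> fst (snd t) = ?N"
        by (auto simp: mem_finite_perm_factors_iff finite_perm_mult_def)
      then have "fst (fst t) \<subseteq> ?N" "fst (snd t) \<subseteq> ?N" by blast+
      then show "class_fun a (fst t) * class_fun b (snd t) = 0"
        using vanish[of a "fst t"] vanish[of b "snd t"] a b t by auto
    qed
  qed (auto simp: finite_finite_perm_factors)
  also have "\<dots> = (\<Sum>t\<in>perm_factors n w. class_fun_fin n a (fst t) * class_fun_fin n b (snd t))"
  proof (rule sum.reindex_bij_witness[where i = "\<lambda>t. ((?N, fst t), (?N, snd t))" and
        j = "\<lambda>t. (snd (fst t), snd (snd t))"])
    fix t assume t: "t \<in> ?F'"
    then have *: "fst t \<in> finite_perms" "snd t \<in> finite_perms" "fst (fst t) = ?N" "fst (snd t) = ?N"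
        "snd (fst t) \<circ> snd (snd t) = w"
      by (auto simp: mem_finite_perm_factors_iff finite_perm_mult_def)
    show "((?N, fst (snd (fst t), snd (snd t))), (?N, snd (snd (fst t), snd (snd t)))) = t"
      using * by (simp add: prod_eq_iff)
    have "snd (fst t) permutes ?N" "snd (snd t) permutes ?N"
      using * by (metis mem_finite_perms_iff)+
    then show "(snd (fst t), snd (snd t)) \<in> perm_factors n w"
      "class_fun_fin n a (fst (snd (fst t), snd (snd t))) * class_fun_fin n b (snd (snd (fst t), snd (snd t))) =
        class_fun a (fst t) * class_fun b (snd t)"
      using * by (simp_all add: mem_perm_factors_iff class_fun_def class_fun_fin_def)
  next
    fix t assume "t \<in> perm_factors n w"
    then show "((?N, fst t), (?N, snd t)) \<in> ?F'"
      using assms(1) by (simp add: mem_perm_factors_iff mem_finite_perm_factors_iff mem_finite_perms_iff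
          finite_perm_mult_def)
  qed auto
  finally show ?thesis by (simp add: group_algebra_mult_apply)
qed

lemma group_algebra_mult_outside:
  assumes "\<not> w permutes {1..n}"
  shows "group_algebra_mult n x y w = 0"
proof -
  have "t \<notin> perm_factors n w" for t
    using assms permutes_compose[of "snd t" "{1..n}" "fst t"] by (auto simp: mem_perm_factors_iff)
  then have "perm_factors n w = {}" by blast
  then show ?thesis by (simp add: group_algebra_mult_apply)
qed

text \<open>
  The description of \<^const>\<open>class_coeff\<close> determines it: the coefficients exist because the product is a
  class function, and are unique because every diagram of degree \<open>n\<close> is the type of a permutation.
\<close>

lemma group_algebra_mult_G_fin:
  assumes n: "n > 0" and \<Delta>: "\<Delta>1 \<in> young_of_degree n" "\<Delta>2 \<in> young_of_degree n"
  shows "group_algebra_mult n (G_fin n \<Delta>1) (G_fin n \<Delta>2) = class_fun_fin n (class_coeff n \<Delta>1 \<Delta>2)"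
proof -
  let ?P = "group_algebra_mult n (G_fin n \<Delta>1) (G_fin n \<Delta>2)"
  have expand: "(\<Sum>\<Delta>\<in>young_of_degree n. fscale (C \<Delta>) (G_fin n \<Delta>)) = class_fun_fin n C" for C
    by (rule ext) (simp add: class_fun_fin_eq_sum[OF n] sum_fun_apply fscale_def)
  let ?spec = "\<lambda>C. (\<forall>\<Delta>. \<Delta> \<notin> young_of_degree n \<longrightarrow> C \<Delta> = 0) \<and>
      ?P = (\<Sum>\<Delta>\<in>young_of_degree n. fscale (C \<Delta>) (G_fin n \<Delta>))"
  obtain c where c: "A_inf_mult (G_inf \<Delta>1) (G_inf \<Delta>2) = class_fun c"
    using G_inf_mult_eq_class_fun by blast
  define C where "C \<Delta> = (if \<Delta> \<in> young_of_degree n then c \<Delta> else 0)" for \<Delta>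
  have "?P = class_fun_fin n C"
  proof
    fix w
    show "?P w = class_fun_fin n C w"
    proof (cases "w permutes {1..n}")
      case True
      have "?P w = class_fun c ({1..n}, w)"
        unfolding c[symmetric] G_fin_eq_class_fun_fin G_inf_eq_class_fun
        by (rule group_algebra_mult_eq_A_inf_mult[OF n True]) (use \<Delta> in \<open>auto simp: indicator_def\<close>)
      also have "\<dots> = class_fun_fin n C w"
        using True n cyclic_type_symmetric_group[OF n True]
        by (simp add: class_fun_def class_fun_fin_def C_def mem_finite_perms_iff)
      finally show ?thesis .
    next
      case False
      then show ?thesis by (simp add: group_algebra_mult_outside class_fun_fin_def)
    qed
  qed
  moreover have "\<forall>\<Delta>. \<Delta> \<notin> young_of_degree n \<longrightarrow> C \<Delta> = 0" by (simp add: C_def)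
  ultimately have "?spec C" unfolding expand by blast
  moreover have "C' = C" if "?spec C'" for C'
  proof
    fix T
    show "C' T = C T"
    proof (cases "T \<in> young_of_degree n")
      case True
      then show ?thesis
        using class_fun_fin_inj[of n C' C T] that \<open>?spec C\<close> unfolding expand by metis
    next
      case False
      then show ?thesis using that \<open>?spec C\<close> by metis
    qed
  qed
  ultimately have "?spec (class_coeff n \<Delta>1 \<Delta>2)"
    unfolding class_coeff_def by (rule theI)
  then show ?thesis unfolding expand by blast
qed

lemma A_circ_mult_apply:
  assumes a: "\<And>\<Delta>. \<Delta> \<notin> young_of_degree n \<Longrightarrow> a \<Delta> = 0"
    and b: "\<And>\<Delta>. \<Delta> \<notin> young_of_degree n \<Longrightarrow> b \<Delta> = 0"
  shows "A_circ_mult n a b T = (if T \<in> young_of_degree n then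
    \<Sum>\<Delta>1\<in>young_of_degree n. \<Sum>\<Delta>2\<in>young_of_degree n. a \<Delta>1 * (b \<Delta>2 * class_coeff n \<Delta>1 \<Delta>2 T) else 0)"
proof -
  let ?Y = "young_of_degree n"
  have inner: "(\<Sum>\<Delta>\<in>?Y. fscale (C \<Delta>) (indicator {\<Delta>})) T = (if T \<in> ?Y then C T else 0)" for C
  proof -
    have "(\<Sum>\<Delta>\<in>?Y. fscale (C \<Delta>) (indicator {\<Delta>})) T = (\<Sum>\<Delta>\<in>?Y. if \<Delta> = T then C \<Delta> else 0)"
      unfolding sum_fun_apply by (rule sum.cong) (auto simp: fscale_def)
    then show ?thesis by (simp add: finite_young_of_degree)
  qed
  have "A_circ_mult n a b T = (\<Sum>\<Delta>1\<in>?Y. \<Sum>\<Delta>2\<in>?Y. a \<Delta>1 * (b \<Delta>2 *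
      (\<Sum>\<Delta>\<in>?Y. fscale (class_coeff n \<Delta>1 \<Delta>2 \<Delta>) (indicator {\<Delta>})) T))"
    unfolding A_circ_mult_def
    by (rule bilin_ext_apply) (use a b in \<open>auto simp: finite_young_of_degree\<close>)
  then show ?thesis by (simp add: inner)
qed

lemma class_fun_fin_A_circ_mult:
  assumes n: "n > 0" and a: "\<And>\<Delta>. \<Delta> \<notin> young_of_degree n \<Longrightarrow> a \<Delta> = 0"
    and b: "\<And>\<Delta>. \<Delta> \<notin> young_of_degree n \<Longrightarrow> b \<Delta> = 0"
  shows "class_fun_fin n (A_circ_mult n a b) = group_algebra_mult n (class_fun_fin n a) (class_fun_fin n b)"
proof
  fix w
  let ?Y = "young_of_degree n"
  show "class_fun_fin n (A_circ_mult n a b) w = group_algebra_mult n (class_fun_fin n a) (class_fun_fin n b) w"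
  proof (cases "w permutes {1..n}")
    case True
    have "group_algebra_mult n (class_fun_fin n a) (class_fun_fin n b) w =
        (\<Sum>\<Delta>1\<in>?Y. \<Sum>\<Delta>2\<in>?Y. a \<Delta>1 * (b \<Delta>2 * group_algebra_mult n (G_fin n \<Delta>1) (G_fin n \<Delta>2) w))"
      unfolding group_algebra_mult_apply class_fun_fin_eq_sum[OF n] by (rule sum_product_bilinear)
    also have "\<dots> = (\<Sum>\<Delta>1\<in>?Y. \<Sum>\<Delta>2\<in>?Y. a \<Delta>1 * (b \<Delta>2 * class_coeff n \<Delta>1 \<Delta>2 (cyclic_type {1..n} w)))"
      using True by (intro sum.cong refl) (simp add: group_algebra_mult_G_fin[OF n] class_fun_fin_def)
    also have "\<dots> = class_fun_fin n (A_circ_mult n a b) w"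
      using True cyclic_type_symmetric_group[OF n True]
      by (simp add: class_fun_fin_def A_circ_mult_apply[OF a b])
    finally show ?thesis by simp
  next
    case False
    then show ?thesis by (simp add: group_algebra_mult_outside class_fun_fin_def)
  qed
qed

section \<open>The brackets are the homogeneous components of the product\<close>

lemma rho_indicator_outside:
  assumes "\<Delta> \<in> young_diagrams" "sum_mset \<Delta> \<le> n" "T \<notin> young_of_degree n"
  shows "rho (n - sum_mset \<Delta>) (indicator {\<Delta>}) T = 0"
  by (rule rho_outside[of "sum_mset \<Delta>"]) (use assms in \<open>auto simp: indicator_def young_of_degree_def\<close>)

text \<open>
  The value of \<open>rho k x\<close> in degree \<open>n\<close> depends only on the part of \<open>x\<close> of degree \<open>n - k\<close>.
\<close>

lemma rho_of_degree:
  assumes "x \<in> A_circ_inf" "T \<in> young_of_degree n" "k \<le> n"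
    and "\<And>\<Delta>. \<Delta> \<in> young_of_degree (n - k) \<Longrightarrow> x \<Delta> = 0"
  shows "rho k x T = 0"
proof (cases "k \<le> count T 1 \<and> k < n")
  case True
  then have "T - replicate_mset k 1 \<in> young_of_degree (n - k)"
    by (intro young_of_degree_remove_unit_rows) (use assms in auto)
  then show ?thesis using assms by (simp add: rho_apply A_circ_inf_def)
next
  case False
  then consider "\<not> k \<le> count T 1" | "k \<le> count T 1" "k = n" using assms(3) by linarith
  then show ?thesis
  proof cases
    case 1
    then show ?thesis using assms(1) by (simp add: rho_apply A_circ_inf_def binomial_eq_0)
  next
    case 2
    then have "sum_mset (T - replicate_mset k 1) = 0"
      using remove_unit_rows(2)[OF 2(1)] assms(2) by (simp add: young_of_degree_def)
    then have "T - replicate_mset k 1 \<notin> young_diagrams"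
      by (auto simp: young_diagrams_def sum_mset_0_iff) (metis multiset_nonemptyE)
    then show ?thesis using assms(1) by (auto simp: rho_apply A_circ_inf_def)
  qed
qed

lemma perm_eval_class_fun_rho:
  assumes "n > 0" "a \<in> A_circ_inf"
  shows "perm_eval n (class_fun a) = class_fun_fin n (\<lambda>T. \<Sum>k\<le>n. rho k a T)"
proof
  fix w
  have a0: "a {#} = 0" using assms(2) by (auto simp: A_circ_inf_def young_diagrams_def)
  show "perm_eval n (class_fun a) w = class_fun_fin n (\<lambda>T. \<Sum>k\<le>n. rho k a T) w"
  proof (cases "w permutes {1..n}")
    case True
    then show ?thesis
      using perm_eval_class_fun[of w n a, OF True a0] assms(2)
      by (simp add: class_fun_fin_def rho_apply A_circ_inf_def)
  next
    case False
    have "class_fun a (d, w) = 0" if "d \<subseteq> {1..n}" for d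
      using False that permutes_subset[of w d "{1..n}"] by (auto simp: class_fun_def mem_finite_perms_iff)
    then show ?thesis using False by (simp add: perm_eval_def class_fun_fin_def)
  qed
qed

text \<open>
  In \<^const>\<open>perm_eval\<close> of a single \<^const>\<open>G_inf\<close> \<open>\<Delta>\<close> only the term \<open>k = n - |\<Delta>|\<close> survives.
\<close>

lemma perm_eval_G_inf:
  assumes "\<Delta> \<in> young_diagrams" "sum_mset \<Delta> \<le> n" "n > 0"
  shows "perm_eval n (G_inf \<Delta>) = class_fun_fin n (rho (n - sum_mset \<Delta>) (indicator {\<Delta>}))"
proof -
  let ?k = "n - sum_mset \<Delta>"
  let ?i = "indicator {\<Delta>} :: nat multiset \<Rightarrow> complex"
  have i: "?i \<in> A_circ_inf" using assms(1) by (rule indicator_in_A_circ_inf)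
  have "(\<Sum>k\<le>n. rho k ?i T) = rho ?k ?i T" if T: "T \<in> young_of_degree n" for T
  proof -
    have "(\<Sum>k\<le>n. rho k ?i T) = (\<Sum>k\<in>{?k}. rho k ?i T)"
    proof (rule sum.mono_neutral_right)
      show "\<forall>k\<in>{..n} - {?k}. rho k ?i T = 0"
      proof
        fix k assume k: "k \<in> {..n} - {?k}"
        show "rho k ?i T = 0"
          by (rule rho_of_degree[OF i T]) (use k assms(2) in \<open>auto simp: young_of_degree_def indicator_def\<close>)
      qed
    qed auto
    then show ?thesis by simp
  qed
  then show ?thesis
    using cyclic_type_symmetric_group[OF assms(3)]
    by (auto simp: G_inf_eq_class_fun perm_eval_class_fun_rho[OF assms(3) i] class_fun_fin_def fun_eq_iff)
qed

text \<open>
  Both sides are the coefficients of the evaluation of \<open>G_inf \<Delta>1 * G_inf \<Delta>2\<close> in degree \<open>n\<close>: on the left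
  it is computed factor by factor, on the right from the expansion of the product.
\<close>

lemma A_circ_mult_rho_eq:
  assumes \<Delta>: "\<Delta>1 \<in> young_diagrams" "\<Delta>2 \<in> young_diagrams" and n: "n > 0" "max_degree \<Delta>1 \<Delta>2 \<le> n"
    and c: "c \<in> A_circ_inf" "A_inf_mult (G_inf \<Delta>1) (G_inf \<Delta>2) = class_fun c"
  shows "A_circ_mult n (rho (n - sum_mset \<Delta>1) (indicator {\<Delta>1})) (rho (n - sum_mset \<Delta>2) (indicator {\<Delta>2})) T =
    (if T \<in> young_of_degree n then \<Sum>k\<le>n. rho k c T else 0)"
proof -
  let ?r1 = "rho (n - sum_mset \<Delta>1) (indicator {\<Delta>1})" and ?r2 = "rho (n - sum_mset \<Delta>2) (indicator {\<Delta>2})"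
  have r: "\<And>T. T \<notin> young_of_degree n \<Longrightarrow> ?r1 T = 0" "\<And>T. T \<notin> young_of_degree n \<Longrightarrow> ?r2 T = 0"
    using rho_indicator_outside \<Delta> n by auto
  have "class_fun_fin n (A_circ_mult n ?r1 ?r2) = group_algebra_mult n (class_fun_fin n ?r1) (class_fun_fin n ?r2)"
    by (rule class_fun_fin_A_circ_mult[OF n(1) r])
  also have "\<dots> = group_algebra_mult n (perm_eval n (G_inf \<Delta>1)) (perm_eval n (G_inf \<Delta>2))"
    using \<Delta> n by (simp add: perm_eval_G_inf)
  also have "\<dots> = perm_eval n (A_inf_mult (G_inf \<Delta>1) (G_inf \<Delta>2))"
    by (rule perm_eval_mult[symmetric]) (simp_all add: G_inf_eq_class_fun class_fun_def)
  also have "\<dots> = class_fun_fin n (\<lambda>T. \<Sum>k\<le>n. rho k c T)"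
    by (simp add: c(2) perm_eval_class_fun_rho[OF n(1) c(1)])
  finally show ?thesis
    using class_fun_fin_inj[of n "A_circ_mult n ?r1 ?r2" _ T] A_circ_mult_apply[OF r] by auto
qed

text \<open>
  Solving \<open>A_circ_mult_rho_eq\<close> for the term \<open>rho 0 c = c\<close> gives the part of \<open>c\<close> of degree \<open>n\<close> as the
  product of the stabilised factors minus the stabilisations of the parts of lower degree. This is
  the recursion that defines \<^const>\<open>bracket\<close>.
\<close>

lemma bracket_eq:
  assumes \<Delta>: "\<Delta>1 \<in> young_diagrams" "\<Delta>2 \<in> young_diagrams"
    and c: "c \<in> A_circ_inf" "A_inf_mult (G_inf \<Delta>1) (G_inf \<Delta>2) = class_fun c"
    and deg: "\<And>\<Delta>. c \<Delta> \<noteq> 0 \<Longrightarrow> max_degree \<Delta>1 \<Delta>2 \<le> sum_mset \<Delta>"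
    and n: "max_degree \<Delta>1 \<Delta>2 \<le> n"
  shows "bracket \<Delta>1 \<Delta>2 n T = (if T \<in> young_of_degree n then c T else 0)"
  using n
proof (induction n arbitrary: T rule: less_induct)
  case (less n)
  let ?M = "max_degree \<Delta>1 \<Delta>2"
  have finc: "finite {\<Delta>. c \<Delta> \<noteq> 0}" using c(1) by (simp add: A_circ_inf_def)
  \<comment> \<open>Positive degree matters: there are no diagrams of degree 0, while the symmetric group on the
    empty set still has one element.\<close>
  obtain m where "m \<in># \<Delta>1" "m \<noteq> 0"
    using \<Delta>(1) unfolding young_diagrams_def by (metis (mono_tags, lifting) mem_Collect_eq multiset_nonemptyE)
  then have "?M > 0" by (metis gr0I less_max_iff_disj sum_mset_0_iff)
  then have n0: "n > 0" using less.prems by linarith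
  \<comment> \<open>the homogeneous component of \<open>c\<close> of degree \<open>k\<close>\<close>
  define ck where "ck k = (\<lambda>\<Delta>. if \<Delta> \<in> young_of_degree k then c \<Delta> else 0)" for k
  have br: "bracket \<Delta>1 \<Delta>2 k = ck k" if "k \<in> {?M..<n}" for k
    using less.IH[of k] that by (auto simp: ck_def fun_eq_iff)
  have out: "rho (n - k) (ck k) T = 0" if "k \<in> {?M..<n}" "T \<notin> young_of_degree n" for k
    by (rule rho_outside[of k]) (use that in \<open>auto simp: ck_def\<close>)
  have inn: "rho (n - k) (ck k) T = rho (n - k) c T" if k: "k \<in> {?M..<n}" and T: "T \<in> young_of_degree n" for k
  proof (cases "n - k \<le> count T 1")
    case True
    have "T - replicate_mset (n - k) 1 \<in> young_of_degree k"
      by (rule young_of_degree_remove_unit_rows[OF True]) (use T k \<open>?M > 0\<close> in auto)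
    moreover have "finite {\<Delta>. ck k \<Delta> \<noteq> 0}"
      by (rule finite_support_young_of_degree[of k]) (simp add: ck_def)
    ultimately show ?thesis by (simp add: rho_apply finc) (simp add: ck_def)
  next
    case False
    moreover have "finite {\<Delta>. ck k \<Delta> \<noteq> 0}"
      by (rule finite_support_young_of_degree[of k]) (simp add: ck_def)
    ultimately show ?thesis by (simp add: rho_apply finc binomial_eq_0)
  qed
  have step: "bracket \<Delta>1 \<Delta>2 n T = (if T \<in> young_of_degree n then \<Sum>k\<le>n. rho k c T else 0)
      - (\<Sum>k\<in>{?M..<n}. rho (n - k) (ck k) T)"
    by (subst bracket.simps) (simp add: A_circ_mult_rho_eq[OF \<Delta> n0 less.prems c] sum_fun_apply br)
  show ?case
  proof (cases "T \<in> young_of_degree n")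
    case False
    then show ?thesis using step out by simp
  next
    case True
    have "(\<Sum>k\<le>n. rho k c T) = (\<Sum>k\<le>n. rho (n - k) c T)"
      by (rule sum.reindex_bij_witness[where i = "\<lambda>k. n - k" and j = "\<lambda>k. n - k"]) auto
    also have "\<dots> = (\<Sum>k\<in>{?M..n}. rho (n - k) c T)"
    proof (rule sum.mono_neutral_right)
      show "\<forall>k\<in>{..n} - {?M..n}. rho (n - k) c T = 0"
      proof
        fix k assume k: "k \<in> {..n} - {?M..n}"
        have "c \<Delta> = 0" if "\<Delta> \<in> young_of_degree (n - (n - k))" for \<Delta>
          using deg[of \<Delta>] k that by (auto simp: young_of_degree_def)
        then show "rho (n - k) c T = 0" by (intro rho_of_degree[OF c(1) True]) auto
      qed
    qed auto
    also have "\<dots> = (\<Sum>k\<in>{?M..<n}. rho (n - k) c T) + rho 0 c T"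
      using less.prems by (simp add: sum.last_plus)
    also have "rho 0 c T = c T" by (simp add: rho_apply finc)
    finally show ?thesis using step True inn by simp
  qed
qed

section \<open>The isomorphism\<close>

definition young_prod :: "nat multiset \<Rightarrow> nat multiset \<Rightarrow> nat multiset \<Rightarrow> complex" where
  "young_prod \<Delta>1 \<Delta>2 = (\<Sum>n = max_degree \<Delta>1 \<Delta>2..sum_mset \<Delta>1 + sum_mset \<Delta>2. bracket \<Delta>1 \<Delta>2 n)"

lemma class_fun_young_prod:
  assumes "\<Delta>1 \<in> young_diagrams" "\<Delta>2 \<in> young_diagrams"
  shows "young_prod \<Delta>1 \<Delta>2 \<in> A_circ_inf" "class_fun (young_prod \<Delta>1 \<Delta>2) = A_inf_mult (G_inf \<Delta>1) (G_inf \<Delta>2)"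
proof -
  obtain c where c: "c \<in> A_circ_inf" "A_inf_mult (G_inf \<Delta>1) (G_inf \<Delta>2) = class_fun c"
    and deg: "\<And>\<Delta>. c \<Delta> \<noteq> 0 \<Longrightarrow> max_degree \<Delta>1 \<Delta>2 \<le> sum_mset \<Delta> \<and> sum_mset \<Delta> \<le> sum_mset \<Delta>1 + sum_mset \<Delta>2"
    by (rule G_inf_mult_eq_class_fun[of \<Delta>1 \<Delta>2]) blast
  have "young_prod \<Delta>1 \<Delta>2 = c"
  proof
    fix T
    let ?I = "{max_degree \<Delta>1 \<Delta>2..sum_mset \<Delta>1 + sum_mset \<Delta>2}"
    have "young_prod \<Delta>1 \<Delta>2 T = (\<Sum>n\<in>?I. if T \<in> young_of_degree n then c T else 0)"
      unfolding young_prod_def sum_fun_apply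
      by (rule sum.cong[OF refl], rule bracket_eq[OF assms c]) (use deg in auto)
    also have "\<dots> = (\<Sum>n\<in>?I. if n = sum_mset T then c T else 0)"
      by (rule sum.cong[OF refl]) (use c(1) in \<open>auto simp: young_of_degree_def A_circ_inf_def\<close>)
    also have "\<dots> = c T" using deg[of T] by auto
    finally show "young_prod \<Delta>1 \<Delta>2 T = c T" .
  qed
  then show "young_prod \<Delta>1 \<Delta>2 \<in> A_circ_inf" "class_fun (young_prod \<Delta>1 \<Delta>2) = A_inf_mult (G_inf \<Delta>1) (G_inf \<Delta>2)"
    using c by simp_all
qed

lemma A_circ_inf_mult_eq: "A_circ_inf_mult = bilin_ext young_prod"
  unfolding A_circ_inf_mult_def young_prod_def ..

lemma A_circ_inf_mult_closed:
  assumes "x \<in> A_circ_inf" "y \<in> A_circ_inf"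
  shows "A_circ_inf_mult x y \<in> A_circ_inf"
  unfolding A_circ_inf_mult_eq bilin_ext_def lin_ext_def
  by (intro fun_space.subspace_sum[OF subspace_A_circ_inf] fun_space.subspace_scale[OF subspace_A_circ_inf]
      class_fun_young_prod(1))
    (use assms in \<open>auto simp: A_circ_inf_def\<close>)

lemma class_fun_eq_sum:
  assumes "x \<in> A_circ_inf"
  shows "class_fun x p = (\<Sum>\<Delta>\<in>{\<Delta>. x \<Delta> \<noteq> 0}. x \<Delta> * G_inf \<Delta> p)"
proof -
  have fin: "finite {\<Delta>. x \<Delta> \<noteq> 0}" using assms by (simp add: A_circ_inf_def)
  show ?thesis unfolding G_inf_map_eq_class_fun[OF assms, symmetric] G_inf_map_def
    by (rule lin_ext_apply[OF fin order_refl])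
qed

lemma class_fun_A_circ_inf_mult:
  assumes x: "x \<in> A_circ_inf" and y: "y \<in> A_circ_inf"
  shows "class_fun (A_circ_inf_mult x y) = A_inf_mult (class_fun x) (class_fun y)"
proof
  fix p
  let ?S = "{\<Delta>. x \<Delta> \<noteq> 0}" and ?T = "{\<Delta>. y \<Delta> \<noteq> 0}"
  have fin: "finite ?S" "finite ?T" and sub: "?S \<subseteq> young_diagrams" "?T \<subseteq> young_diagrams"
    using x y by (auto simp: A_circ_inf_def)
  have "A_inf_mult (class_fun x) (class_fun y) p =
      (\<Sum>\<Delta>1\<in>?S. \<Sum>\<Delta>2\<in>?T. x \<Delta>1 * (y \<Delta>2 * A_inf_mult (G_inf \<Delta>1) (G_inf \<Delta>2) p))"
    unfolding A_inf_mult_apply class_fun_eq_sum[OF x] class_fun_eq_sum[OF y]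
    by (rule sum_product_bilinear)
  also have "\<dots> = (\<Sum>\<Delta>1\<in>?S. \<Sum>\<Delta>2\<in>?T. x \<Delta>1 * (y \<Delta>2 * class_fun (young_prod \<Delta>1 \<Delta>2) p))"
    by (intro sum.cong refl) (use sub in \<open>auto simp: class_fun_young_prod(2) subset_iff\<close>)
  also have "\<dots> = class_fun (A_circ_inf_mult x y) p"
    unfolding A_circ_inf_mult_eq class_fun_def
    by (simp add: bilin_ext_apply[OF fin(1) order_refl fin(2) order_refl])
  finally show "class_fun (A_circ_inf_mult x y) p = A_inf_mult (class_fun x) (class_fun y) p" by simp
qed

lemma is_algebra_A_inf: "is_algebra A_inf A_inf_mult"
proof -
  have "fun_space.subspace A_inf" unfolding A_inf_def by simp
  moreover have "A_inf_mult x y \<in> A_inf" if xy: "x \<in> A_inf" "y \<in> A_inf" for x y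
  proof -
    obtain a b where "a \<in> A_circ_inf" "b \<in> A_circ_inf" "x = class_fun a" "y = class_fun b"
      using xy unfolding A_inf_eq_image by blast
    then show ?thesis
      unfolding A_inf_eq_image by (metis class_fun_A_circ_inf_mult A_circ_inf_mult_closed image_eqI)
  qed
  ultimately show ?thesis
    by (simp add: is_algebra_def A_inf_mult_add_left A_inf_mult_add_right A_inf_mult_scale_left
        A_inf_mult_scale_right A_inf_mult_assoc)
qed

text \<open>
  Associativity of the stable product is not visible from its definition; it is pulled back along the
  injective multiplicative map \<^const>\<open>class_fun\<close>.
\<close>

lemma is_algebra_A_circ_inf: "is_algebra A_circ_inf A_circ_inf_mult"
  unfolding is_algebra_def
proof (intro conjI ballI allI)
  note closed = A_circ_inf_mult_closed fun_space.subspace_add[OF subspace_A_circ_inf]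
    fun_space.subspace_scale[OF subspace_A_circ_inf]
  note hom = class_fun_A_circ_inf_mult class_fun_add class_fun_scale
  fix x y z c assume "x \<in> A_circ_inf" "y \<in> A_circ_inf" "z \<in> A_circ_inf"
  note simps = this closed hom
  show "A_circ_inf_mult (x + y) z = A_circ_inf_mult x z + A_circ_inf_mult y z"
    by (rule class_fun_inj) (simp_all add: simps A_inf_mult_add_left)
  show "A_circ_inf_mult z (x + y) = A_circ_inf_mult z x + A_circ_inf_mult z y"
    by (rule class_fun_inj) (simp_all add: simps A_inf_mult_add_right)
  show "A_circ_inf_mult (A_circ_inf_mult x y) z = A_circ_inf_mult x (A_circ_inf_mult y z)"
    by (rule class_fun_inj) (simp_all add: simps A_inf_mult_assoc)
next
  note closed = A_circ_inf_mult_closed fun_space.subspace_scale[OF subspace_A_circ_inf]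
  fix x y c assume "x \<in> A_circ_inf" "y \<in> A_circ_inf"
  note simps = this closed class_fun_A_circ_inf_mult class_fun_scale
  show "A_circ_inf_mult (fscale c x) y = fscale c (A_circ_inf_mult x y)"
    by (rule class_fun_inj) (simp_all add: simps A_inf_mult_scale_left)
  show "A_circ_inf_mult x (fscale c y) = fscale c (A_circ_inf_mult x y)"
    by (rule class_fun_inj) (simp_all add: simps A_inf_mult_scale_right)
qed (auto intro: subspace_A_circ_inf A_circ_inf_mult_closed)

theorem theorem2p2:
  shows "(\<forall>\<Delta>\<in>young_diagrams. G_inf_map (indicator {\<Delta>}) = G_inf \<Delta>) \<and>
         is_algebra_iso A_circ_inf A_circ_inf_mult A_inf A_inf_mult G_inf_map"
proof
  show "\<forall>\<Delta>\<in>young_diagrams. G_inf_map (indicator {\<Delta>}) = G_inf \<Delta>"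
    by (simp add: G_inf_map_eq_class_fun indicator_in_A_circ_inf G_inf_eq_class_fun)
  note closed = A_circ_inf_mult_closed fun_space.subspace_add[OF subspace_A_circ_inf]
    fun_space.subspace_scale[OF subspace_A_circ_inf]
  have "bij_betw class_fun A_circ_inf A_inf"
    unfolding bij_betw_def A_inf_eq_image by (auto intro!: inj_onI class_fun_inj)
  then have "bij_betw G_inf_map A_circ_inf A_inf"
    by (subst bij_betw_cong[of _ _ class_fun]) (simp_all add: G_inf_map_eq_class_fun)
  then show "is_algebra_iso A_circ_inf A_circ_inf_mult A_inf A_inf_mult G_inf_map"
    unfolding is_algebra_iso_def
    by (simp add: is_algebra_A_circ_inf is_algebra_A_inf closed G_inf_map_eq_class_fun
        class_fun_A_circ_inf_mult class_fun_add class_fun_scale)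
qed

end
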